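(* Let $\Gamma$ be a second countable, locally compact group. If $\Gamma$ admits a proper, affine, isometric action on a space $L_p(\mu)$ for some $0<p<2$ (and some measure $\mu$), then $\Gamma$ is a-T-menable.
   Context: Scalars: all vector spaces are over a fixed field, either $\mathbb{R}$ or $\mathbb{C}$. For a measure $\mu$ and $0<p<\infty$, $L_p(\mu)$ is the usual space of ($\mu$-a.e. classes of) measurable functions $f$ with $\|f\|^p:=\int|f|^p\,d\mu<\infty$. For $p\ge 1$ it is a normed space with norm $\|\cdot\|$; for $0<p<1$ it is regarded as a metric vector space with the translation-invariant metric $d(f,h)=\|f-h\|^p=\int|f-h|^p\,d\mu$. An affine, isometric action of a group $\Gamma$ on such a space $X$ is an action of the form $\Psi(g)v=\pi(g)v+\gamma(g)$ for $v\in X$, $g\in\Gamma$, where $\pi$ is a representation of $\Gamma$ on $X$ by (invertible) linear isometries and $\gamma:\Gamma\to X$ satisfies the cocycle identity $\gamma(gh)=\pi(g)\gamma(h)+\gamma(g)$ for all $g,h\in\Gamma$. As usual for topological groups, actions are understood to be continuous: for every $v\in X$ the orbit map $g\mapsto\Psi(g)v$ is continuous. An isometric action of $\Gamma$ on a metric space $X$ is proper if for every bounded set $\mathcal{U}\subset X$ the set $\{g\in\Gamma : g\,\mathcal{U}\cap\mathcal{U}\neq\emptyset\}$ is relatively compact in $\Gamma$ (finite, when $\Gamma$ is discrete). For affine isometric actions on normed spaces this is the same as $\lim_{g\to\infty}\|\Psi(g)v\|=\infty$ for every $v\in X$, equivalently $\lim_{g\to\infty}\|\gamma(g)\|=\infty$,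 where $g\to\infty$ means that $g$ leaves every compact subset of $\Gamma$. A second countable, locally compact group is a-T-menable (has the Haagerup approximation property) if it admits a proper, affine, isometric action on a separable Hilbert space. *)

theory Defs
  imports "HOL-Analysis.Analysis" "HOL-Algebra.Module"
begin

text \<open>
  The scalar field is a subset \<open>K\<close> of the complex numbers, either \<open>\<real>\<close> or \<open>UNIV\<close>.
  Vector spaces over \<open>K\<close> are modules over the following ring; only the fields
  \<^const>\<open>carrier\<close>, \<^const>\<open>zero\<close>, \<^const>\<open>add\<close> and \<^const>\<open>smult\<close> of the record of a module matter.
\<close>

definition scalar_ring :: "complex set \<Rightarrow> complex ring" where
  "scalar_ring K = \<lparr>carrier = K, mult = (*), one = 1, zero = 0, add = (+)\<rparr>"

definition Lp_funs :: "complex set \<Rightarrow> real \<Rightarrow> 'm measure \<Rightarrow> ('m \<Rightarrow> complex) set" where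
  "Lp_funs K p M = {f \<in> borel_measurable M.
     (\<forall>x\<in>space M. f x \<in> K) \<and> integrable M (\<lambda>x. norm (f x) powr p)}"

definition ae_eq :: "complex set \<Rightarrow> real \<Rightarrow> 'm measure \<Rightarrow> (('m \<Rightarrow> complex) \<times> ('m \<Rightarrow> complex)) set" where
  "ae_eq K p M = {(f, h). f \<in> Lp_funs K p M \<and> h \<in> Lp_funs K p M \<and> (AE x in M. f x = h x)}"

abbreviation ae_class :: "complex set \<Rightarrow> real \<Rightarrow> 'm measure \<Rightarrow> ('m \<Rightarrow> complex) \<Rightarrow> ('m \<Rightarrow> complex) set" where
  "ae_class K p M f \<equiv> ae_eq K p M `` {f}"

definition rep :: "('m \<Rightarrow> complex) set \<Rightarrow> 'm \<Rightarrow> complex" where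
  "rep A = (SOME f. f \<in> A)"

definition Lp_space :: "complex set \<Rightarrow> real \<Rightarrow> 'm measure \<Rightarrow> (complex, ('m \<Rightarrow> complex) set) module" where
  "Lp_space K p M =
     \<lparr>carrier = Lp_funs K p M // ae_eq K p M,
      mult = undefined, one = undefined,
      zero = ae_class K p M (\<lambda>x. 0),
      add = (\<lambda>A B. ae_class K p M (\<lambda>x. rep A x + rep B x)),
      smult = (\<lambda>c A. ae_class K p M (\<lambda>x. c * rep A x))\<rparr>"

definition Lp_norm :: "real \<Rightarrow> 'm measure \<Rightarrow> ('m \<Rightarrow> complex) \<Rightarrow> real" where
  "Lp_norm p M f = (LINT x|M. norm (f x) powr p) powr (1 / p)"

definition Lp_dist :: "real \<Rightarrow> 'm measure \<Rightarrow> ('m \<Rightarrow> complex) set \<Rightarrow> ('m \<Rightarrow> complex) set \<Rightarrow> real" where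
  "Lp_dist p M A B =
     (let r = Lp_norm p M (\<lambda>x. rep A x - rep B x) in if 1 \<le> p then r else r powr p)"

locale inner_product_space = Module.module "scalar_ring K" H
  for K :: "complex set" and H :: "(complex, 'v, 'r) module_scheme" (structure) +
  fixes ip :: "'v \<Rightarrow> 'v \<Rightarrow> complex"
  assumes ip_closed: "\<lbrakk>x \<in> carrier H; y \<in> carrier H\<rbrakk> \<Longrightarrow> ip x y \<in> K"
    and ip_commute: "\<lbrakk>x \<in> carrier H; y \<in> carrier H\<rbrakk> \<Longrightarrow> ip x y = cnj (ip y x)"
    and ip_add: "\<lbrakk>x \<in> carrier H; y \<in> carrier H; z \<in> carrier H\<rbrakk> \<Longrightarrow> ip (x \<oplus> y) z = ip x z + ip y z"
    and ip_smult: "\<lbrakk>c \<in> K; x \<in> carrier H; y \<in> carrier H\<rbrakk> \<Longrightarrow> ip (c \<odot> x) y = c * ip x y"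
    and ip_nonneg: "x \<in> carrier H \<Longrightarrow> 0 \<le> Re (ip x x)"
    and ip_definite: "\<lbrakk>x \<in> carrier H; ip x x = 0\<rbrakk> \<Longrightarrow> x = \<zero>"

text \<open>The library's \<^locale>\<open>Metric_space\<close> wants distances to be nonnegative and symmetric also
  outside the carrier, hence the case distinction.\<close>

definition ip_dist :: "(complex, 'v, 'r) module_scheme \<Rightarrow> ('v \<Rightarrow> 'v \<Rightarrow> complex) \<Rightarrow> 'v \<Rightarrow> 'v \<Rightarrow> real" where
  "ip_dist H ip x y =
     (if x \<in> carrier H \<and> y \<in> carrier H then sqrt (Re (ip (x \<ominus>\<^bsub>H\<^esub> y) (x \<ominus>\<^bsub>H\<^esub> y))) else 0)"

definition separable_Hilbert_space ::
    "complex set \<Rightarrow> (complex, 'v, 'r) module_scheme \<Rightarrow> ('v \<Rightarrow> 'v \<Rightarrow> complex) \<Rightarrow> bool" where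
  "separable_Hilbert_space K H ip \<longleftrightarrow>
     inner_product_space K H ip \<and>
     Metric_space.mcomplete (carrier H) (ip_dist H ip) \<and>
     separable_space (Metric_space.mtopology (carrier H) (ip_dist H ip))"

locale topological_group = group G
  for G :: "('g, 'c) monoid_scheme" (structure) +
  fixes T :: "'g topology"
  assumes topspace_eq: "topspace T = carrier G"
    and continuous_mult: "continuous_map (prod_topology T T) T (\<lambda>(x, y). x \<otimes> y)"
    and continuous_inv: "continuous_map T T (\<lambda>x. inv x)"

text \<open>Below, \<open>V\<close> is a vector space over \<open>K\<close> and \<open>d\<close> a translation-invariant metric on it.\<close>

definition linear_isometry ::
    "complex set \<Rightarrow> (complex, 'v, 'r) module_scheme \<Rightarrow> ('v \<Rightarrow> 'v \<Rightarrow> real) \<Rightarrow> ('v \<Rightarrow> 'v) \<Rightarrow> bool" where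
  "linear_isometry K V d L \<longleftrightarrow>
     bij_betw L (carrier V) (carrier V) \<and>
     (\<forall>x\<in>carrier V. \<forall>y\<in>carrier V. L (x \<oplus>\<^bsub>V\<^esub> y) = L x \<oplus>\<^bsub>V\<^esub> L y) \<and>
     (\<forall>c\<in>K. \<forall>x\<in>carrier V. L (c \<odot>\<^bsub>V\<^esub> x) = c \<odot>\<^bsub>V\<^esub> L x) \<and>
     (\<forall>x\<in>carrier V. \<forall>y\<in>carrier V. d (L x) (L y) = d x y)"

definition isometric_representation ::
    "('g, 'c) monoid_scheme \<Rightarrow> complex set \<Rightarrow> (complex, 'v, 'r) module_scheme \<Rightarrow>
     ('v \<Rightarrow> 'v \<Rightarrow> real) \<Rightarrow> ('g \<Rightarrow> 'v \<Rightarrow> 'v) \<Rightarrow> bool" where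
  "isometric_representation G K V d \<pi> \<longleftrightarrow>
     (\<forall>g\<in>carrier G. linear_isometry K V d (\<pi> g)) \<and>
     (\<forall>v\<in>carrier V. \<pi> \<one>\<^bsub>G\<^esub> v = v) \<and>
     (\<forall>g\<in>carrier G. \<forall>h\<in>carrier G. \<forall>v\<in>carrier V. \<pi> (g \<otimes>\<^bsub>G\<^esub> h) v = \<pi> g (\<pi> h v))"

definition cocycle ::
    "('g, 'c) monoid_scheme \<Rightarrow> (complex, 'v, 'r) module_scheme \<Rightarrow>
     ('g \<Rightarrow> 'v \<Rightarrow> 'v) \<Rightarrow> ('g \<Rightarrow> 'v) \<Rightarrow> bool" where
  "cocycle G V \<pi> \<gamma> \<longleftrightarrow>
     (\<forall>g\<in>carrier G. \<gamma> g \<in> carrier V) \<and>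
     (\<forall>g\<in>carrier G. \<forall>h\<in>carrier G. \<gamma> (g \<otimes>\<^bsub>G\<^esub> h) = \<pi> g (\<gamma> h) \<oplus>\<^bsub>V\<^esub> \<gamma> g)"

definition affine_isometric_action ::
    "('g, 'c) monoid_scheme \<Rightarrow> 'g topology \<Rightarrow> complex set \<Rightarrow> (complex, 'v, 'r) module_scheme \<Rightarrow>
     ('v \<Rightarrow> 'v \<Rightarrow> real) \<Rightarrow> ('g \<Rightarrow> 'v \<Rightarrow> 'v) \<Rightarrow> bool" where
  "affine_isometric_action G T K V d \<Psi> \<longleftrightarrow>
     (\<exists>\<pi> \<gamma>. isometric_representation G K V d \<pi> \<and> cocycle G V \<pi> \<gamma> \<and>
        (\<forall>g\<in>carrier G. \<forall>v\<in>carrier V. \<Psi> g v = \<pi> g v \<oplus>\<^bsub>V\<^esub> \<gamma> g)) \<and>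
     (\<forall>v\<in>carrier V. continuous_map T (Metric_space.mtopology (carrier V) d) (\<lambda>g. \<Psi> g v))"

definition proper_action ::
    "('g, 'c) monoid_scheme \<Rightarrow> 'g topology \<Rightarrow> 'v set \<Rightarrow> ('v \<Rightarrow> 'v \<Rightarrow> real) \<Rightarrow>
     ('g \<Rightarrow> 'v \<Rightarrow> 'v) \<Rightarrow> bool" where
  "proper_action G T X d \<Psi> \<longleftrightarrow>
     (\<forall>U. Metric_space.mbounded X d U \<longrightarrow>
        compactin T (T closure_of {g \<in> carrier G. \<Psi> g ` U \<inter> U \<noteq> {}}))"

definition admits_proper_affine_isometric_action ::
    "('g, 'c) monoid_scheme \<Rightarrow> 'g topology \<Rightarrow> complex set \<Rightarrow> (complex, 'v, 'r) module_scheme \<Rightarrow>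
     ('v \<Rightarrow> 'v \<Rightarrow> real) \<Rightarrow> bool" where
  "admits_proper_affine_isometric_action G T K V d \<longleftrightarrow>
     (\<exists>\<Psi>. affine_isometric_action G T K V d \<Psi> \<and> proper_action G T (carrier V) d \<Psi>)"

text \<open>A definition cannot quantify over types, so the underlying set of the Hilbert space is taken
  inside \<^typ>\<open>nat \<Rightarrow> complex\<close>. A separable metric space has at most continuum many points, so
  this loses no generality: the vector space operations and the inner product are arbitrary.\<close>

definition a_T_menable :: "complex set \<Rightarrow> ('g, 'c) monoid_scheme \<Rightarrow> 'g topology \<Rightarrow> bool" where
  "a_T_menable K G T \<longleftrightarrow>
     (\<exists>(H :: (complex, nat \<Rightarrow> complex) module) ip.
        separable_Hilbert_space K H ip \<and>
        admits_proper_affine_isometric_action G T K H (ip_dist H ip))"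

end

theory Submission
  imports Defs "HOL-Library.Function_Algebras"
begin

text \<open>
  Let \<open>\<gamma>\<close> be the cocycle of the given action and \<open>k g h = \<parallel>\<gamma> g - \<gamma> h\<parallel>\<^sup>p\<close>, the integral of
  \<open>\<bar>\<gamma> g - \<gamma> h\<bar>\<^sup>p\<close>. This kernel is invariant under left translations, continuous and proper.
  For \<open>0 < p < 2\<close> it is also conditionally negative definite (Schoenberg): pointwise,
  \<open>\<bar>z - w\<bar>\<^sup>p\<close> is a positive mixture of the kernels \<open>1 - exp (- t * \<bar>z - w\<bar>\<^sup>2)\<close>. Hence
  \<open>\<kappa> g h = k g \<one> + k h \<one> - k g h\<close> is the Gram matrix of vectors \<open>b g\<close> of a Hilbert space, with
  \<open>\<parallel>b g - b h\<parallel>\<^sup>2 = 2 * k g h\<close>. By invariance, \<open>b k \<mapsto> b (g \<otimes> k) - b g\<close> extends to a linear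
  isometry of the span of the \<open>b k\<close>, and \<open>b\<close> is a cocycle for the resulting representation; it is
  proper since \<open>k\<close> is. The vectors \<open>b g\<close> are obtained concretely, as square-summable sequences, by
  running the Cholesky factorization of \<open>\<kappa>\<close> along a dense sequence of \<open>G\<close>; its nonzero pivots
  index an orthonormal basis of the closed span.
\<close>

section \<open>Powers of the distance in the plane are conditionally negative definite\<close>

text \<open>Three obstacles shape the argument. The vectors of the Hilbert space must live in
  \<open>nat \<Rightarrow> complex\<close>, so the usual quotient and completion of finitely
  supported functions on the group gives way to an explicit matrix factorization; second
  countability supplies the dense sequence, and continuity of \<open>k\<close> makes elimination
  along it exhaust the whole kernel. The scalars may be real or complex: the entries of the factor
  are real, so the same vectors serve both fields. Finally, the \<open>b k\<close> may be linearly
  dependent, so the word "extends" hides a question of well-definedness. The isometry is therefore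
  introduced as a relation between vectors, tested by inner products; uniqueness comes from density,
  existence from approximation by finite combinations. The bound \<open>p < 2\<close> enters through
  the mixture: near 0 its integrand behaves like \<open>t powr (- p / 2)\<close>, which has to be
  integrable.\<close>

definition psd_form :: "('i \<Rightarrow> 'i \<Rightarrow> real) \<Rightarrow> 'i set \<Rightarrow> ('i \<Rightarrow> real) \<Rightarrow> real" where
  "psd_form M F c = (\<Sum>i\<in>F. \<Sum>j\<in>F. c i * c j * M i j)"

lemma psd_form_rank_one: "psd_form (\<lambda>i j. w i * w j) F c = (\<Sum>i\<in>F. c i * w i)\<^sup>2"
  by (simp add: psd_form_def power2_eq_square sum_product mult_ac)

lemma psd_form_weight: "psd_form (\<lambda>i j. w i * w j * M i j) F c = psd_form M F (\<lambda>i. c i * w i)"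
  by (simp add: psd_form_def mult_ac)

lemma psd_form_add: "psd_form (\<lambda>i j. M i j + N i j) F c = psd_form M F c + psd_form N F c"
  by (simp add: psd_form_def distrib_left sum.distrib)

lemma psd_form_diff: "psd_form (\<lambda>i j. M i j - N i j) F c = psd_form M F c - psd_form N F c"
  by (simp add: psd_form_def right_diff_distrib sum_subtractf)

lemma psd_form_scale: "psd_form (\<lambda>i j. r * M i j) F c = r * psd_form M F c"
  by (simp add: psd_form_def sum_distrib_left mult_ac)

text \<open>Expand the exponential: the n-th term contributes \<open>a ^ n / fact n\<close> times
  the form of \<open>M\<close> at the reweighted vector \<open>c i * x i ^ n\<close>, which is
  nonnegative, and the 0-th term is the form of \<open>M\<close> itself. The comparison with
  \<open>M\<close>, rather than mere positivity, is what later allows the constant 1 to be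
  subtracted.\<close>

lemma psd_form_exp_mono:
  assumes psd: "\<And>c. 0 \<le> psd_form M F c" and a: "a \<ge> 0"
  shows "psd_form M F c \<le> psd_form (\<lambda>i j. exp (a * (x i * x j)) * M i j) F c"
proof -
  define T where "T n = psd_form (\<lambda>i j. (a * (x i * x j)) ^ n /\<^sub>R fact n * M i j) F c" for n
  have T: "T n = a ^ n / fact n * psd_form M F (\<lambda>i. c i * x i ^ n)" for n
    unfolding T_def psd_form_def
    by (simp add: sum_distrib_left power_mult_distrib divide_inverse mult_ac)
  have "(\<lambda>n. c i * c j * ((a * (x i * x j)) ^ n /\<^sub>R fact n * M i j)) sums
      (c i * c j * (exp (a * (x i * x j)) * M i j))" for i j
    by (intro sums_mult sums_mult2 exp_converges)
  then have sums: "T sums psd_form (\<lambda>i j. exp (a * (x i * x j)) * M i j) F c"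
    unfolding T_def psd_form_def by (intro sums_sum)
  have "sum T {0} \<le> psd_form (\<lambda>i j. exp (a * (x i * x j)) * M i j) F c"
    using sums_unique[OF sums] sums_summable[OF sums]
    by (metis T a finite.emptyI finite.insertI divide_nonneg_nonneg mult_nonneg_nonneg psd
        sum_le_suminf zero_le_power fact_ge_zero)
  then show ?thesis
    by (simp add: T)
qed

text \<open>The Gaussian factors as \<open>w i * w j * E i j\<close>, and the kernel becomes the
  rank one kernel \<open>(1 - w i) * (1 - w j)\<close> plus a reweighting of \<open>E - 1\<close>.
  The form of \<open>E\<close> dominates that of the constant 1.\<close>

lemma psd_form_one_minus_gaussian:
  fixes z :: "'i \<Rightarrow> complex"
  assumes t: "t \<ge> 0"
  shows "0 \<le> psd_form (\<lambda>i j. (1 - exp (- t * (cmod (z i))\<^sup>2)) + (1 - exp (- t * (cmod (z j))\<^sup>2))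
                  - (1 - exp (- t * (cmod (z i - z j))\<^sup>2))) F c"
proof -
  define w where "w i = exp (- t * (cmod (z i))\<^sup>2)" for i
  \<comment> \<open>This is the exponential of \<open>2 * t\<close> times the real inner product of
    \<open>z i\<close> and \<open>z j\<close> in the plane. The nesting, ending in the constant
    kernel 1, lets \<open>psd_form_exp_mono\<close> be applied once per coordinate.\<close>
  define E where "E i j = exp (2 * t * (Im (z i) * Im (z j))) *
    (exp (2 * t * (Re (z i) * Re (z j))) * 1)" for i j
  have eq: "(1 - exp (- t * (cmod (z i))\<^sup>2)) + (1 - exp (- t * (cmod (z j))\<^sup>2))
                  - (1 - exp (- t * (cmod (z i - z j))\<^sup>2)) =
      (1 - w i) * (1 - w j) + w i * w j * (E i j - 1)" for i j
  proof -
    have "- t * (cmod (z i - z j))\<^sup>2 = - t * (cmod (z i))\<^sup>2 - t * (cmod (z j))\<^sup>2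
        + 2 * t * (Re (z i) * Re (z j)) + 2 * t * (Im (z i) * Im (z j))"
      unfolding cmod_power2 minus_complex.sel by (simp add: power2_eq_square algebra_simps)
    then have "exp (- t * (cmod (z i - z j))\<^sup>2) = w i * w j * E i j"
      by (simp only: w_def E_def exp_add exp_diff mult_1_right) (simp add: exp_minus field_simps)
    then show ?thesis by (simp add: w_def algebra_simps)
  qed
  have 1: "0 \<le> psd_form (\<lambda>i j. 1) F c" for c
    using psd_form_rank_one[of "\<lambda>_. 1" F c] by simp
  have 2: "psd_form (\<lambda>i j. 1) F c \<le> psd_form (\<lambda>i j. exp (2 * t * (Re (z i) * Re (z j))) * 1) F c" for c
    using t by (intro psd_form_exp_mono 1) simp
  then have "psd_form (\<lambda>i j. 1) F c \<le> psd_form E F c" for c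
    unfolding E_def using 1 t
    by (intro order_trans[OF 2] psd_form_exp_mono) (auto intro: order_trans)
  then have "0 \<le> psd_form (\<lambda>i j. w i * w j * (E i j - 1)) F c"
    by (simp add: psd_form_weight psd_form_diff)
  then show ?thesis
    unfolding eq psd_form_add psd_form_rank_one by simp
qed

text \<open>The case \<open>s = 1\<close> of the integrand
  \<open>(1 - exp (- t * s)) * t powr (- 1 - a)\<close>, whose integral over the positive half-line
  is a constant times \<open>s powr a\<close>. This is the Levy-Khintchine representation of the
  Bernstein function \<open>s powr a\<close>; the integral of \<open>bernstein a\<close> is that
  constant.\<close>

definition bernstein :: "real \<Rightarrow> real \<Rightarrow> real" where
  "bernstein a t = indicator {0<..} t * ((1 - exp (- t)) * t powr (- 1 - a))"

lemma bernstein_measurable [measurable]: "bernstein a \<in> borel_measurable borel"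
  unfolding bernstein_def[abs_def] by measurable

lemma bernstein_nonneg: "0 \<le> bernstein a t"
  by (auto simp: bernstein_def indicator_def)

lemma bernstein_nonpos: "t \<le> 0 \<Longrightarrow> bernstein a t = 0"
  by (simp add: bernstein_def)

text \<open>The first bound is integrable near 0 because \<open>a < 1\<close>, the second near
  infinity because \<open>a > 0\<close>.\<close>

lemma bernstein_le:
  assumes "t > 0"
  shows "bernstein a t \<le> t powr (- a)" "bernstein a t \<le> t powr (- 1 - a)"
proof -
  have eq: "bernstein a t = (1 - exp (- t)) * t powr (- 1 - a)"
    using assms by (simp add: bernstein_def)
  have "1 - exp (- t) \<le> t"
    using exp_ge_add_one_self[of "- t"] by linarith
  then have "bernstein a t \<le> t * t powr (- 1 - a)"
    unfolding eq by (rule mult_right_mono) simp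
  also have "\<dots> = t powr (- a)"
    using assms powr_add[of t 1 "- 1 - a"] by simp
  finally show "bernstein a t \<le> t powr (- a)" .
  have "bernstein a t \<le> 1 * t powr (- 1 - a)"
    unfolding eq by (rule mult_right_mono) simp_all
  then show "bernstein a t \<le> t powr (- 1 - a)" by simp
qed

lemma integrable_bernstein:
  assumes "0 < a" "a < 1"
  shows "integrable lborel (bernstein a)"
proof -
  define f where "f t = (if t \<in> {0..1} then t powr (- a) else 0)" for t :: real
  define g where "g t = (if t \<in> {1..} then t powr (- 1 - a) else 0)" for t :: real
  have "(\<lambda>t. t powr (- a)) integrable_on {0..1}"
    using assms by (intro integrable_on_powr_from_0) auto
  then have f: "f integrable_on UNIV"
    unfolding f_def[abs_def] by (simp only: integrable_restrict_UNIV)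
  have "(\<lambda>t. t powr (- 1 - a)) integrable_on {1..}"
    using assms by (intro has_integral_integrable[OF has_integral_powr_to_inf]) auto
  then have g: "g integrable_on UNIV"
    unfolding g_def[abs_def] by (simp only: integrable_restrict_UNIV)
  \<comment> \<open>A nonnegative gauge integrable function is Lebesgue integrable with respect to
    the completed measure; Borel measurability then brings it back to \<open>lborel\<close>.\<close>
  have "integrable lebesgue f" "integrable lebesgue g"
    using nonnegative_absolutely_integrable_1[OF f] nonnegative_absolutely_integrable_1[OF g]
    by (simp_all add: f_def[abs_def] g_def[abs_def] set_integrable_def)
  moreover have [measurable]: "f \<in> borel_measurable borel" "g \<in> borel_measurable borel"
    unfolding f_def[abs_def] g_def[abs_def] by measurable
  ultimately have "integrable lborel f" "integrable lborel g"
    by (simp_all add: integrable_completion)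
  then have "integrable lborel (\<lambda>t. f t + g t)"
    by simp
  then show ?thesis
  proof (rule Bochner_Integration.integrable_bound)
    have "norm (bernstein a t) \<le> norm (f t + g t)" for t
    proof -
      have "0 \<le> f t" "0 \<le> g t" "0 < t \<Longrightarrow> t \<le> 1 \<Longrightarrow> f t = t powr (- a)"
        "1 \<le> t \<Longrightarrow> g t = t powr (- 1 - a)"
        by (simp_all add: f_def g_def)
      then show ?thesis
        using bernstein_nonneg[of a t] bernstein_le[of t a] bernstein_nonpos[of t a]
        unfolding real_norm_def by linarith
    qed
    then show "AE t in lborel. norm (bernstein a t) \<le> norm (f t + g t)" by (rule AE_I2)
    show "bernstein a \<in> borel_measurable lborel" by measurable
  qed
qed

text \<open>Substituting \<open>s * t\<close> for \<open>t\<close> in \<open>bernstein a\<close>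
  pulls out the power of \<open>s\<close>. For \<open>s = 0\<close> both sides vanish.\<close>

lemma powr_eq_integral:
  assumes a: "0 < a" "a < 1" and s: "0 \<le> s"
  shows "integrable lborel (\<lambda>t. indicator {0<..} t * ((1 - exp (- t * s)) * t powr (- 1 - a)))" (is ?I)
    and "(LBINT t. indicator {0<..} t * ((1 - exp (- t * s)) * t powr (- 1 - a))) =
           s powr a * integral\<^sup>L lborel (bernstein a)" (is ?E)
proof -
  have "?I \<and> ?E"
  proof (cases "s = 0")
    case False
    with s have s: "s > 0" by simp
    have eq: "bernstein a (0 + s * t) = s powr (- 1 - a) *
        (indicator {0<..} t * ((1 - exp (- t * s)) * t powr (- 1 - a)))" for t
      using s by (auto simp: bernstein_def indicator_def powr_mult zero_less_mult_iff mult.commute)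
    have "integrable lborel (\<lambda>t. bernstein a (0 + s * t))"
      using s by (intro lborel_integrable_real_affine integrable_bernstein a) auto
    then have I: ?I using s unfolding eq by simp
    have "integral\<^sup>L lborel (bernstein a) = s * (s powr (- 1 - a) *
       (LBINT t. indicator {0<..} t * ((1 - exp (- t * s)) * t powr (- 1 - a))))"
      using s lborel_integral_real_affine[of s "bernstein a" 0] unfolding eq by simp
    moreover have "s * s powr (- 1 - a) = inverse (s powr a)"
      using s powr_add[of s 1 "- 1 - a"] by (simp add: powr_minus)
    ultimately have ?E
      using s by (simp add: field_simps)
    with I show ?thesis ..
  qed simp
  then show ?I ?E by auto
qed

text \<open>The integrand is positive on the interval from 1 to 2. Positivity of this constant
  allows it to be divided out of the mixture.\<close>

lemma integral_bernstein_pos: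
  assumes "0 < a" "a < 1"
  shows "0 < integral\<^sup>L lborel (bernstein a)"
proof -
  have "integral\<^sup>L lborel (bernstein a) \<noteq> 0"
  proof
    assume "integral\<^sup>L lborel (bernstein a) = 0"
    then have "AE t in lborel. bernstein a t = 0"
      using integral_nonneg_eq_0_iff_AE[OF integrable_bernstein[OF assms]] bernstein_nonneg by simp
    then have "AE t in lborel. t \<notin> {1<..<2::real}"
      by eventually_elim (auto simp: bernstein_def)
    then have "emeasure lborel {1<..<2::real} = 0"
      by (subst (asm) AE_iff_measurable[where N="{1<..<2}"]) auto
    then show False by simp
  qed
  moreover have "0 \<le> integral\<^sup>L lborel (bernstein a)"
    by (simp add: bernstein_nonneg)
  ultimately show ?thesis by simp
qed

text \<open>Schoenberg: integrate the Gaussian kernels against the weight of \<open>powr_eq_integral\<close>.\<close>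

lemma psd_form_powr:
  fixes z :: "'i \<Rightarrow> complex"
  assumes p: "0 < p" "p < 2"
  shows "0 \<le> psd_form (\<lambda>i j. cmod (z i) powr p + cmod (z j) powr p - cmod (z i - z j) powr p) F c"
proof -
  \<comment> \<open>Gaussians depend on the squared modulus, so the exponent is halved;
    \<open>p < 2\<close> becomes \<open>a < 1\<close>.\<close>
  define a where "a = p / 2"
  have a: "0 < a" "a < 1" using p by (auto simp: a_def)
  define C where "C = integral\<^sup>L lborel (bernstein a)"
  define h where "h s t = indicator {0<..} t * ((1 - exp (- t * s)) * t powr (- 1 - a))" for s t :: real
  have C: "C > 0" using integral_bernstein_pos a by (simp add: C_def)
  have h: "integrable lborel (h s)" "integral\<^sup>L lborel (h s) = s powr a * C" if "s \<ge> 0" for s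
    using powr_eq_integral[OF a that] unfolding h_def[abs_def] C_def by simp_all
  have pw: "cmod x powr p = (cmod x)\<^sup>2 powr a" for x
    by (cases "x = 0") (simp_all add: a_def powr_powr flip: powr_numeral)
  let ?H = "\<lambda>t i j. h ((cmod (z i))\<^sup>2) t + h ((cmod (z j))\<^sup>2) t - h ((cmod (z i - z j))\<^sup>2) t"
  have "?H t i j = indicator {0<..} t * t powr (- 1 - a) *
      ((1 - exp (- t * (cmod (z i))\<^sup>2)) + (1 - exp (- t * (cmod (z j))\<^sup>2))
                  - (1 - exp (- t * (cmod (z i - z j))\<^sup>2)))" for t i j
    by (simp add: h_def algebra_simps)
  then have "0 \<le> psd_form (?H t) F c" for t
    using psd_form_one_minus_gaussian[of t z F c]
    by (cases "t > 0") (simp_all only: psd_form_scale, simp_all add: zero_le_mult_iff)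
  then have "0 \<le> (LBINT t. psd_form (?H t) F c)"
    by simp
  also have "\<dots> = psd_form (\<lambda>i j. (LBINT t. ?H t i j)) F c"
    unfolding psd_form_def by (simp add: h)
  also have "\<dots> = psd_form (\<lambda>i j. C * (cmod (z i) powr p + cmod (z j) powr p - cmod (z i - z j) powr p)) F c"
    by (simp add: h pw algebra_simps)
  also have "\<dots> = C * psd_form (\<lambda>i j. cmod (z i) powr p + cmod (z j) powr p - cmod (z i - z j) powr p) F c"
    by (rule psd_form_scale)
  finally show ?thesis
    using C by (simp add: zero_le_mult_iff)
qed

section \<open>Cholesky factorization of positive semidefinite kernels\<close>

lemma psd_form_Suc:
  "psd_form M {..<Suc n} c =
    psd_form M {..<n} c + c n * (\<Sum>i<n. c i * (M i n + M n i)) + (c n)\<^sup>2 * M n n"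
  by (simp add: psd_form_def sum.distrib distrib_left sum_distrib_left power2_eq_square mult_ac)

lemma psd_form_cong:
  assumes "\<And>i. i \<in> F \<Longrightarrow> c i = d i" "\<And>i j. i \<in> F \<Longrightarrow> j \<in> F \<Longrightarrow> M i j = N i j"
  shows "psd_form M F c = psd_form N F d"
  unfolding psd_form_def using assms by (intro sum.cong refl) simp

text \<open>Points are listed by a finite sequence with repetitions allowed, so that a point can be
  appended without asking whether it already occurs. For a symmetric real kernel, real coefficients
  carry all the information.\<close>

definition psd_kernel :: "'a set \<Rightarrow> ('a \<Rightarrow> 'a \<Rightarrow> real) \<Rightarrow> bool" where
  "psd_kernel X \<kappa> \<longleftrightarrow> (\<forall>x\<in>X. \<forall>y\<in>X. \<kappa> x y = \<kappa> y x) \<and>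
     (\<forall>n z c. (\<forall>i<n. z i \<in> X) \<longrightarrow> 0 \<le> psd_form (\<lambda>i j. \<kappa> (z i) (z j)) {..<n::nat} c)"

lemma psd_kernel_sym: "psd_kernel X \<kappa> \<Longrightarrow> x \<in> X \<Longrightarrow> y \<in> X \<Longrightarrow> \<kappa> x y = \<kappa> y x"
  unfolding psd_kernel_def by blast

lemma psd_kernel_form:
  "psd_kernel X \<kappa> \<Longrightarrow> (\<And>i. i < n \<Longrightarrow> z i \<in> X) \<Longrightarrow> 0 \<le> psd_form (\<lambda>i j. \<kappa> (z i) (z j)) {..<n} c"
  for z :: "nat \<Rightarrow> _"
  unfolding psd_kernel_def by blast

lemma psd_kernel_diag:
  assumes "psd_kernel X \<kappa>" "x \<in> X"
  shows "0 \<le> \<kappa> x x"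
  using psd_kernel_form[OF assms(1), of "Suc 0" "\<lambda>_. x" "\<lambda>_. 1"] assms(2)
  unfolding psd_form_Suc by (simp add: psd_form_def)

lemma psd_kernel_two_points:
  assumes "psd_kernel X \<kappa>" "x \<in> X" "y \<in> X"
  shows "0 \<le> \<kappa> x x + 2 * t * \<kappa> x y + t\<^sup>2 * \<kappa> y y"
proof -
  have "0 \<le> psd_form (\<lambda>i j. \<kappa> (if i = 0 then x else y) (if j = 0 then x else y)) {..<Suc (Suc 0)}
      (\<lambda>i. if i = 0 then 1 else t)"
    using assms by (intro psd_kernel_form) auto
  then show ?thesis
    using psd_kernel_sym[OF assms]
    unfolding psd_form_Suc by (simp add: psd_form_def algebra_simps power2_eq_square)
qed

text \<open>A weak form of Cauchy-Schwarz, from the coefficients 1 and -1. It suffices later because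
  both diagonal values tend to 0.\<close>

lemma psd_kernel_abs_le:
  assumes "psd_kernel X \<kappa>" "x \<in> X" "y \<in> X"
  shows "2 * \<bar>\<kappa> x y\<bar> \<le> \<kappa> x x + \<kappa> y y"
  using psd_kernel_two_points[OF assms, of 1] psd_kernel_two_points[OF assms, of "- 1"] by auto

text \<open>With \<open>\<kappa> y y = 0\<close> the two-point form is affine in \<open>t\<close>,
  hence bounded below only if its slope vanishes. The chosen \<open>t\<close> would make it equal to
  -1.\<close>

lemma psd_kernel_zero_diag:
  assumes "psd_kernel X \<kappa>" "x \<in> X" "y \<in> X" and 0: "\<kappa> y y = 0"
  shows "\<kappa> x y = 0"
proof (rule ccontr)
  assume "\<kappa> x y \<noteq> 0"
  then show False
    using psd_kernel_two_points[OF assms(1-3), of "- (\<kappa> x x + 1) / (2 * \<kappa> x y)"] 0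
    by (simp add: field_simps)
qed

text \<open>Append \<open>q\<close> with coefficient \<open>t\<close> to the given points. The form
  becomes \<open>Q + 2 * t * S + t\<^sup>2 * \<kappa> q q\<close>, whose minimum, at
  \<open>t = - S / \<kappa> q q\<close>, is the form of the Schur complement.\<close>

lemma psd_kernel_schur_complement:
  fixes X :: "'a set"
  assumes psd: "psd_kernel X \<kappa>" and q: "q \<in> X"
  shows "psd_kernel X (\<lambda>x y. \<kappa> x y - \<kappa> x q * \<kappa> y q / \<kappa> q q)"
  unfolding psd_kernel_def
proof (intro conjI ballI allI impI)
  fix x y assume "x \<in> X" "y \<in> X"
  then show "\<kappa> x y - \<kappa> x q * \<kappa> y q / \<kappa> q q = \<kappa> y x - \<kappa> y q * \<kappa> x q / \<kappa> q q"
    using psd_kernel_sym[OF psd] by (simp add: mult.commute)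
next
  fix n and z :: "nat \<Rightarrow> 'a" and c :: "nat \<Rightarrow> real"
  assume z: "\<forall>i<n. z i \<in> X"
  define S where "S = (\<Sum>i<n. c i * \<kappa> (z i) q)"
  define Q where "Q = psd_form (\<lambda>i j. \<kappa> (z i) (z j)) {..<n} c"
  have ineq: "0 \<le> Q + 2 * t * S + t\<^sup>2 * \<kappa> q q" for t
  proof -
    define z' where "z' = z(n := q)"
    define c' where "c' = c(n := t)"
    have "0 \<le> psd_form (\<lambda>i j. \<kappa> (z' i) (z' j)) {..<Suc n} c'"
      using z q by (intro psd_kernel_form[OF psd]) (auto simp: z'_def)
    also have "\<dots> = Q + t * (\<Sum>i<n. c' i * (\<kappa> (z' i) q + \<kappa> q (z' i))) + t\<^sup>2 * \<kappa> q q"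
      unfolding psd_form_Suc Q_def
      by (intro arg_cong2[where f = "(+)"] psd_form_cong) (auto simp: z'_def c'_def)
    also have "(\<Sum>i<n. c' i * (\<kappa> (z' i) q + \<kappa> q (z' i))) = 2 * S"
      unfolding S_def sum_distrib_left using z q psd_kernel_sym[OF psd, of q]
      by (intro sum.cong) (auto simp: z'_def c'_def)
    finally show ?thesis by (simp add: mult_ac)
  qed
  have "psd_form (\<lambda>i j. \<kappa> (z i) (z j) - \<kappa> (z i) q * \<kappa> (z j) q / \<kappa> q q) {..<n} c =
      Q - (1 / \<kappa> q q) * S\<^sup>2"
    unfolding Q_def S_def
    by (simp only: psd_form_diff psd_form_scale[symmetric] psd_form_rank_one[symmetric]) simp
  moreover have "0 \<le> Q - (1 / \<kappa> q q) * S\<^sup>2"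
  proof (cases "\<kappa> q q = 0")
    case True
    then show ?thesis using ineq[of 0] by simp
  next
    case False
    then show ?thesis
      using ineq[of "- S / \<kappa> q q"] by (simp add: field_simps power2_eq_square)
  qed
  ultimately show "0 \<le> psd_form (\<lambda>i j. \<kappa> (z i) (z j) - \<kappa> (z i) q * \<kappa> (z j) q / \<kappa> q q) {..<n} c"
    by simp
qed

text \<open>Division by a zero pivot gives \<open>0\<close>; this is harmless, since the column of a zero pivot
  of a positive semidefinite kernel vanishes anyway.\<close>

primrec residual :: "('a \<Rightarrow> 'a \<Rightarrow> real) \<Rightarrow> (nat \<Rightarrow> 'a) \<Rightarrow> nat \<Rightarrow> 'a \<Rightarrow> 'a \<Rightarrow> real" where
  "residual \<kappa> q 0 = \<kappa>"
| "residual \<kappa> q (Suc n) = (\<lambda>x y. residual \<kappa> q n x y -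
     residual \<kappa> q n x (q n) * residual \<kappa> q n y (q n) / residual \<kappa> q n (q n) (q n))"

text \<open>The n-th column of the factor, evaluated at every point \<open>x\<close> and not only
  along the sequence \<open>q\<close>; the rows thus give a vector for each element of the
  group.\<close>

definition cholesky :: "('a \<Rightarrow> 'a \<Rightarrow> real) \<Rightarrow> (nat \<Rightarrow> 'a) \<Rightarrow> 'a \<Rightarrow> nat \<Rightarrow> real" where
  "cholesky \<kappa> q x n = residual \<kappa> q n x (q n) / sqrt (residual \<kappa> q n (q n) (q n))"

definition pivots :: "('a \<Rightarrow> 'a \<Rightarrow> real) \<Rightarrow> (nat \<Rightarrow> 'a) \<Rightarrow> nat set" where
  "pivots \<kappa> q = {n. residual \<kappa> q n (q n) (q n) \<noteq> 0}"

lemma cholesky_eq_0: "n \<notin> pivots \<kappa> q \<Longrightarrow> cholesky \<kappa> q x n = 0"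
  by (simp add: cholesky_def pivots_def)

context
  fixes X and \<kappa> :: "'a \<Rightarrow> 'a \<Rightarrow> real" and q :: "nat \<Rightarrow> 'a"
  assumes psd: "psd_kernel X \<kappa>" and q: "\<And>n. q n \<in> X"
begin

lemma psd_residual: "psd_kernel X (residual \<kappa> q n)"
proof (induction n)
  case (Suc n)
  then show ?case using psd_kernel_schur_complement[OF _ q] by simp
qed (simp add: psd)

lemma residual_eq_sum:
  assumes "x \<in> X" "y \<in> X"
  shows "residual \<kappa> q n x y = \<kappa> x y - (\<Sum>k<n. cholesky \<kappa> q x k * cholesky \<kappa> q y k)"
proof (induction n)
  case (Suc n)
  have "0 \<le> residual \<kappa> q n (q n) (q n)"
    by (rule psd_kernel_diag[OF psd_residual q])
  then show ?case using Suc by (simp add: cholesky_def)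
qed simp

text \<open>Elimination at \<open>q m\<close> clears its column, and a zero pivot has a zero column
  to begin with. A later step subtracts a multiple of
  \<open>residual \<kappa> q n (q m) (q n)\<close>, which is already 0 by symmetry, so the column
  stays cleared.\<close>

lemma residual_pivot:
  assumes "x \<in> X" "m < n"
  shows "residual \<kappa> q n x (q m) = 0"
  using assms
proof (induction n arbitrary: x)
  case (Suc n)
  show ?case
  proof (cases "m = n")
    case True
    then show ?thesis
      using psd_kernel_zero_diag[OF psd_residual[of n] Suc.prems(1) q[of n]] by auto
  next
    case False
    then have "m < n" using Suc.prems by simp
    then have "residual \<kappa> q n (q m) (q n) = 0"
      using Suc.IH[OF q] psd_kernel_sym[OF psd_residual q q] by metis
    then show ?thesis using Suc \<open>m < n\<close> by simp
  qed
qed simp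

lemma cholesky_above: "m < n \<Longrightarrow> cholesky \<kappa> q (q m) n = 0"
  using residual_pivot[OF q] psd_kernel_sym[OF psd_residual q q] by (simp add: cholesky_def)

lemma cholesky_diag: "n \<in> pivots \<kappa> q \<Longrightarrow> cholesky \<kappa> q (q n) n \<noteq> 0"
  by (simp add: cholesky_def pivots_def)

text \<open>Geometrically, the distance from \<open>x\<close> to the span of the first
  \<open>n\<close> points is at most the distance from \<open>x\<close> to \<open>q m\<close>. Since
  all residuals involving \<open>q m\<close> vanish, the left-hand side is a residual squared
  distance, and elimination only subtracts squares from squared distances.\<close>

lemma residual_le:
  assumes x: "x \<in> X" and "m < n"
  shows "residual \<kappa> q n x x \<le> \<kappa> x x - 2 * \<kappa> x (q m) + \<kappa> (q m) (q m)"
proof -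
  let ?L = "\<lambda>x k. cholesky \<kappa> q x k"
  have "residual \<kappa> q n x x =
      residual \<kappa> q n x x - 2 * residual \<kappa> q n x (q m) + residual \<kappa> q n (q m) (q m)"
    using residual_pivot[OF x \<open>m < n\<close>] residual_pivot[OF q \<open>m < n\<close>] by simp
  also have "\<dots> = \<kappa> x x - 2 * \<kappa> x (q m) + \<kappa> (q m) (q m) - (\<Sum>k<n. (?L x k - ?L (q m) k)\<^sup>2)"
    by (simp add: residual_eq_sum x q power2_eq_square algebra_simps sum.distrib sum_subtractf
        flip: sum_distrib_left)
  also have "\<dots> \<le> \<kappa> x x - 2 * \<kappa> x (q m) + \<kappa> (q m) (q m)"
    by (simp add: sum_nonneg)
  finally show ?thesis .
qed

lemma residual_diag_tendsto_0:
  assumes x: "x \<in> X"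
    and dense: "\<And>e. e > 0 \<Longrightarrow> \<exists>m. \<kappa> x x - 2 * \<kappa> x (q m) + \<kappa> (q m) (q m) < e"
  shows "(\<lambda>n. residual \<kappa> q n x x) \<longlonglongrightarrow> 0"
proof (rule LIMSEQ_I)
  fix e :: real assume "e > 0"
  then obtain m where "\<kappa> x x - 2 * \<kappa> x (q m) + \<kappa> (q m) (q m) < e"
    using dense by blast
  then have "norm (residual \<kappa> q n x x - 0) < e" if "n \<ge> Suc m" for n
    using residual_le[OF x, of m n] psd_kernel_diag[OF psd_residual x, of n] that by auto
  then show "\<exists>no. \<forall>n\<ge>no. norm (residual \<kappa> q n x x - 0) < e" by blast
qed

text \<open>The remainder after \<open>n\<close> terms is \<open>residual \<kappa> q n x y\<close>,
  which is dominated by the diagonal residuals at \<open>x\<close> and \<open>y\<close>. So the rows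
  of the factor have \<open>\<kappa>\<close> as their Gram matrix.\<close>

lemma cholesky_sums:
  assumes x: "x \<in> X" and y: "y \<in> X"
    and dense: "\<And>x e. x \<in> X \<Longrightarrow> e > 0 \<Longrightarrow>
      \<exists>m. \<kappa> x x - 2 * \<kappa> x (q m) + \<kappa> (q m) (q m) < e"
  shows "(\<lambda>n. cholesky \<kappa> q x n * cholesky \<kappa> q y n) sums \<kappa> x y"
proof -
  have "(\<lambda>n. residual \<kappa> q n x x + residual \<kappa> q n y y) \<longlonglongrightarrow> 0"
    using tendsto_add[OF residual_diag_tendsto_0[OF x dense] residual_diag_tendsto_0[OF y dense]] x y
    by simp
  then have "(\<lambda>n. residual \<kappa> q n x y) \<longlonglongrightarrow> 0"
  proof (rule Lim_null_comparison[rotated])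
    have "norm (residual \<kappa> q n x y) \<le> residual \<kappa> q n x x + residual \<kappa> q n y y" for n
      using psd_kernel_abs_le[OF psd_residual x y, of n] by simp
    then show "\<forall>\<^sub>F n in sequentially.
        norm (residual \<kappa> q n x y) \<le> residual \<kappa> q n x x + residual \<kappa> q n y y" by simp
  qed
  from tendsto_diff[OF tendsto_const[of "\<kappa> x y"] this] show ?thesis
    by (simp add: sums_def residual_eq_sum x y)
qed

end

section \<open>Hilbert spaces of square-summable sequences\<close>

definition scl :: "complex \<Rightarrow> (nat \<Rightarrow> complex) \<Rightarrow> nat \<Rightarrow> complex" where
  "scl c x = (\<lambda>n. c * x n)"

definition ell2 :: "(nat \<Rightarrow> complex) set" where
  "ell2 = {x. summable (\<lambda>n. (cmod (x n))\<^sup>2)}"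

definition l2_inner :: "(nat \<Rightarrow> complex) \<Rightarrow> (nat \<Rightarrow> complex) \<Rightarrow> complex" where
  "l2_inner x y = (\<Sum>n. x n * cnj (y n))"

definition l2_norm :: "(nat \<Rightarrow> complex) \<Rightarrow> real" where
  "l2_norm x = sqrt (\<Sum>n. (cmod (x n))\<^sup>2)"

lemma scl_apply [simp]: "scl c x n = c * x n"
  by (simp add: scl_def)

lemma ell2_add [intro, simp]:
  assumes "x \<in> ell2" "y \<in> ell2"
  shows "x + y \<in> ell2"
  unfolding ell2_def mem_Collect_eq
proof (rule summable_comparison_test')
  show "summable (\<lambda>n. 2 * (cmod (x n))\<^sup>2 + 2 * (cmod (y n))\<^sup>2)"
    using assms by (intro summable_add summable_mult) (auto simp: ell2_def)
  have "(cmod (x n + y n))\<^sup>2 \<le> 2 * (cmod (x n))\<^sup>2 + 2 * (cmod (y n))\<^sup>2" for n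
  proof -
    have "(cmod (x n + y n))\<^sup>2 \<le> (cmod (x n) + cmod (y n))\<^sup>2"
      by (intro power_mono norm_triangle_ineq norm_ge_zero)
    also have "\<dots> \<le> 2 * (cmod (x n))\<^sup>2 + 2 * (cmod (y n))\<^sup>2"
      using sum_squares_bound[of "cmod (x n)" "cmod (y n)"] by (simp add: power2_sum)
    finally show ?thesis .
  qed
  then show "norm ((cmod ((x + y) n))\<^sup>2) \<le> 2 * (cmod (x n))\<^sup>2 + 2 * (cmod (y n))\<^sup>2"
    if "n \<ge> 0" for n by simp
qed

lemma ell2_scl [intro, simp]: "x \<in> ell2 \<Longrightarrow> scl c x \<in> ell2"
  by (simp add: ell2_def norm_mult power_mult_distrib summable_mult)

lemma diff_eq_add_scl: "x - y = x + scl (- 1) y"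
  by (rule ext) simp

lemma ell2_diff [intro, simp]: "x \<in> ell2 \<Longrightarrow> y \<in> ell2 \<Longrightarrow> x - y \<in> ell2"
  unfolding diff_eq_add_scl by simp

lemma ell2_zero [intro, simp]: "0 \<in> ell2"
  by (simp add: ell2_def)

lemma l2_inner_sums:
  assumes "x \<in> ell2" "y \<in> ell2"
  shows "(\<lambda>n. x n * cnj (y n)) sums l2_inner x y"
proof -
  have "summable (\<lambda>n. x n * cnj (y n))"
  proof (rule summable_comparison_test')
    show "summable (\<lambda>n. (cmod (x n))\<^sup>2 + (cmod (y n))\<^sup>2)"
      using assms by (intro summable_add) (auto simp: ell2_def)
    show "norm (x n * cnj (y n)) \<le> (cmod (x n))\<^sup>2 + (cmod (y n))\<^sup>2" if "n \<ge> 0" for n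
    proof -
      have "0 \<le> cmod (x n) * cmod (y n)" by simp
      then show ?thesis
        using sum_squares_bound[of "cmod (x n)" "cmod (y n)"]
        unfolding norm_mult complex_mod_cnj by linarith
    qed
  qed
  then show ?thesis by (simp add: l2_inner_def summable_sums)
qed

lemma l2_inner_add_left:
  assumes "x \<in> ell2" "y \<in> ell2" "z \<in> ell2"
  shows "l2_inner (x + y) z = l2_inner x z + l2_inner y z"
  using sums_unique[OF sums_add[OF l2_inner_sums[OF assms(1,3)] l2_inner_sums[OF assms(2,3)]]]
  by (simp add: l2_inner_def[of "x + y"] algebra_simps)

lemma l2_inner_scl_left:
  assumes "x \<in> ell2" "y \<in> ell2"
  shows "l2_inner (scl c x) y = c * l2_inner x y"
  using sums_unique[OF sums_mult[OF l2_inner_sums[OF assms], of c]]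
  by (simp add: l2_inner_def[of "scl c x"] mult.assoc)

lemma l2_inner_commute:
  assumes "x \<in> ell2" "y \<in> ell2"
  shows "l2_inner x y = cnj (l2_inner y x)"
proof -
  have "(\<lambda>n. cnj (y n * cnj (x n))) sums cnj (l2_inner y x)"
    unfolding sums_cnj by (rule l2_inner_sums[OF assms(2,1)])
  from sums_unique[OF this] show ?thesis
    by (simp add: l2_inner_def[of x] mult.commute)
qed

lemma l2_inner_diff_left:
  assumes "x \<in> ell2" "y \<in> ell2" "z \<in> ell2"
  shows "l2_inner (x - y) z = l2_inner x z - l2_inner y z"
  using assms by (simp add: diff_eq_add_scl l2_inner_add_left l2_inner_scl_left)

lemma l2_inner_add_right:
  assumes "x \<in> ell2" "y \<in> ell2" "z \<in> ell2"
  shows "l2_inner z (x + y) = l2_inner z x + l2_inner z y"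
  using assms by (simp add: l2_inner_commute[of z] l2_inner_add_left)

lemma l2_inner_scl_right:
  assumes "x \<in> ell2" "y \<in> ell2"
  shows "l2_inner y (scl c x) = cnj c * l2_inner y x"
  using assms by (simp add: l2_inner_commute[of y] l2_inner_scl_left)

lemma l2_inner_diff_right:
  assumes "x \<in> ell2" "y \<in> ell2" "z \<in> ell2"
  shows "l2_inner z (x - y) = l2_inner z x - l2_inner z y"
  using assms by (simp add: l2_inner_commute[of z] l2_inner_diff_left)

lemma l2_inner_zero [simp]: "l2_inner 0 y = 0" "l2_inner y 0 = 0"
  by (simp_all add: l2_inner_def)

lemmas l2_inner_linear =
  l2_inner_add_left l2_inner_add_right l2_inner_diff_left l2_inner_diff_right
  l2_inner_scl_left l2_inner_scl_right

lemma l2_norm_nonneg [simp]: "x \<in> ell2 \<Longrightarrow> 0 \<le> l2_norm x"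
  by (simp add: l2_norm_def ell2_def suminf_nonneg)

lemma l2_norm_power2: "x \<in> ell2 \<Longrightarrow> (l2_norm x)\<^sup>2 = (\<Sum>n. (cmod (x n))\<^sup>2)"
  by (simp add: l2_norm_def ell2_def suminf_nonneg)

lemma l2_inner_self:
  assumes "x \<in> ell2"
  shows "l2_inner x x = of_real ((l2_norm x)\<^sup>2)"
proof -
  have "l2_inner x x = (\<Sum>n. of_real ((cmod (x n))\<^sup>2))"
    unfolding l2_inner_def complex_norm_square ..
  also have "\<dots> = of_real (\<Sum>n. (cmod (x n))\<^sup>2)"
    using assms by (simp add: ell2_def suminf_of_real)
  finally show ?thesis by (simp add: l2_norm_power2 assms)
qed

lemma l2_norm_eq_0_iff: "x \<in> ell2 \<Longrightarrow> l2_norm x = 0 \<longleftrightarrow> x = 0"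
  by (auto simp: l2_norm_def ell2_def suminf_eq_zero_iff fun_eq_iff)

lemma l2_norm_zero [simp]: "l2_norm 0 = 0"
  by (simp add: l2_norm_def)

lemma l2_inner_minus_right: "x \<in> ell2 \<Longrightarrow> y \<in> ell2 \<Longrightarrow> l2_inner y (- x) = - l2_inner y x"
  using l2_inner_diff_right[of 0 x y] by simp

lemma L2_set_le_l2_norm: "x \<in> ell2 \<Longrightarrow> finite F \<Longrightarrow> L2_set (\<lambda>n. cmod (x n)) F \<le> l2_norm x"
  unfolding L2_set_def l2_norm_def ell2_def by (auto intro!: sum_le_suminf)

lemma cmod_le_l2_norm: "x \<in> ell2 \<Longrightarrow> cmod (x n) \<le> l2_norm x"
  using L2_set_le_l2_norm[of x "{n}"] by simp

text \<open>The finite inequality bounds every partial sum by the full norms; then pass to the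
  limit.\<close>

lemma l2_Cauchy_Schwarz:
  assumes "x \<in> ell2" "y \<in> ell2"
  shows "cmod (l2_inner x y) \<le> l2_norm x * l2_norm y"
proof (rule LIMSEQ_le_const2)
  show "(\<lambda>N. cmod (\<Sum>n<N. x n * cnj (y n))) \<longlonglongrightarrow> cmod (l2_inner x y)"
    using l2_inner_sums[OF assms] unfolding sums_def by (rule tendsto_norm)
  have "cmod (\<Sum>n<N. x n * cnj (y n)) \<le> l2_norm x * l2_norm y" for N
  proof -
    have "cmod (\<Sum>n<N. x n * cnj (y n)) \<le> (\<Sum>n<N. \<bar>cmod (x n)\<bar> * \<bar>cmod (y n)\<bar>)"
      by (rule order_trans[OF norm_sum]) (simp add: norm_mult)
    also have "\<dots> \<le> L2_set (\<lambda>n. cmod (x n)) {..<N} * L2_set (\<lambda>n. cmod (y n)) {..<N}"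
      by (rule L2_set_mult_ineq)
    also have "\<dots> \<le> l2_norm x * l2_norm y"
      using assms by (intro mult_mono L2_set_le_l2_norm) auto
    finally show ?thesis .
  qed
  then show "\<exists>N. \<forall>n\<ge>N. cmod (\<Sum>n<n. x n * cnj (y n)) \<le> l2_norm x * l2_norm y" by blast
qed

lemma l2_norm_triangle:
  assumes "x \<in> ell2" "y \<in> ell2"
  shows "l2_norm (x + y) \<le> l2_norm x + l2_norm y"
proof -
  have "complex_of_real ((l2_norm (x + y))\<^sup>2) =
      of_real ((l2_norm x)\<^sup>2 + (l2_norm y)\<^sup>2) + (l2_inner x y + cnj (l2_inner x y))"
    by (simp only: of_real_add l2_inner_self[symmetric] assms ell2_add)
      (simp add: l2_inner_linear assms l2_inner_commute[of y x])
  then have "(l2_norm (x + y))\<^sup>2 = (l2_norm x)\<^sup>2 + (l2_norm y)\<^sup>2 + 2 * Re (l2_inner x y)"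
    unfolding complex_add_cnj of_real_add[symmetric] of_real_eq_iff by simp
  also have "\<dots> \<le> (l2_norm x + l2_norm y)\<^sup>2"
    using l2_Cauchy_Schwarz[OF assms] complex_Re_le_cmod[of "l2_inner x y"] by (simp add: power2_sum)
  finally show ?thesis
    by (rule power2_le_imp_le) (simp add: assms)
qed

lemma l2_norm_scl: "x \<in> ell2 \<Longrightarrow> l2_norm (scl c x) = cmod c * l2_norm x"
  by (simp add: l2_norm_def ell2_def norm_mult power_mult_distrib suminf_mult real_sqrt_mult)

lemma l2_norm_minus_commute: "l2_norm (x - y) = l2_norm (y - x)"
  by (simp add: l2_norm_def norm_minus_commute)

lemma l2_norm_triangle_diff:
  assumes "x \<in> ell2" "y \<in> ell2" "z \<in> ell2"
  shows "l2_norm (x - z) \<le> l2_norm (x - y) + l2_norm (y - z)"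
  using l2_norm_triangle[of "x - y" "y - z"] assms by simp

text \<open>The limit is taken coordinatewise. Letting \<open>m\<close> tend to infinity inside
  finite partial sums gives a bound independent of their length, hence convergence in norm.
  Convergence of the coordinates is exported as well, since membership in \<open>l2_carrier\<close>
  is a condition on coordinates.\<close>

lemma l2_complete:
  assumes f: "\<And>n. f n \<in> ell2"
    and Cauchy: "\<And>e. e > 0 \<Longrightarrow> \<exists>N. \<forall>m\<ge>N. \<forall>n\<ge>N. l2_norm (f m - f n) < e"
  obtains x where "x \<in> ell2" "(\<lambda>n. l2_norm (f n - x)) \<longlonglongrightarrow> 0" "\<And>i. (\<lambda>n. f n i) \<longlonglongrightarrow> x i"
proof -
  have "Cauchy (\<lambda>n. f n i)" for i
  proof (rule metric_CauchyI)
    fix e :: real assume "e > 0"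
    with Cauchy obtain N where "\<forall>m\<ge>N. \<forall>n\<ge>N. l2_norm (f m - f n) < e" by blast
    moreover have "dist (f m i) (f n i) \<le> l2_norm (f m - f n)" for m n
      using cmod_le_l2_norm[of "f m - f n" i] f by (simp add: dist_norm)
    ultimately show "\<exists>M. \<forall>m\<ge>M. \<forall>n\<ge>M. dist (f m i) (f n i) < e"
      by (meson order_le_less_trans)
  qed
  then have "\<forall>i. \<exists>l. (\<lambda>n. f n i) \<longlonglongrightarrow> l"
    by (simp add: Cauchy_convergent_iff convergent_def)
  then obtain x where x: "\<And>i. (\<lambda>n. f n i) \<longlonglongrightarrow> x i"
    by metis
  have bound: "\<exists>N. \<forall>n\<ge>N. f n - x \<in> ell2 \<and> l2_norm (f n - x) \<le> e" if "e > 0" for e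
  proof -
    obtain N where N: "\<forall>m\<ge>N. \<forall>n\<ge>N. l2_norm (f m - f n) < e"
      using Cauchy \<open>e > 0\<close> by blast
    have "f n - x \<in> ell2 \<and> l2_norm (f n - x) \<le> e" if n: "n \<ge> N" for n
    proof -
      have le: "(\<Sum>i<k. (cmod ((f n - x) i))\<^sup>2) \<le> e\<^sup>2" for k
      proof (rule LIMSEQ_le_const2)
        show "(\<lambda>m. \<Sum>i<k. (cmod ((f n - f m) i))\<^sup>2) \<longlonglongrightarrow> (\<Sum>i<k. (cmod ((f n - x) i))\<^sup>2)"
          by (simp, intro tendsto_intros x)
        have "(\<Sum>i<k. (cmod ((f n - f m) i))\<^sup>2) \<le> e\<^sup>2" if "m \<ge> N" for m
        proof -
          have "L2_set (\<lambda>i. cmod ((f n - f m) i)) {..<k} \<le> e"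
            using L2_set_le_l2_norm[of "f n - f m" "{..<k}"] N f n that
            by (meson ell2_diff finite_lessThan le_less_trans less_imp_le)
          then show ?thesis
            unfolding L2_set_def by (rule sqrt_le_D)
        qed
        then show "\<exists>N. \<forall>m\<ge>N. (\<Sum>i<k. (cmod ((f n - f m) i))\<^sup>2) \<le> e\<^sup>2" by blast
      qed
      have summable: "summable (\<lambda>i. (cmod ((f n - x) i))\<^sup>2)"
        by (rule summableI_nonneg_bounded[OF _ le]) simp
      then have "(\<Sum>i. (cmod ((f n - x) i))\<^sup>2) \<le> e\<^sup>2"
        using le by (rule suminf_le_const)
      then show ?thesis
        using summable \<open>e > 0\<close> unfolding ell2_def l2_norm_def by (simp add: real_le_lsqrt)
    qed
    then show ?thesis by blast
  qed
  obtain N where "f N - x \<in> ell2" using bound[of 1] by auto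
  then have "f N - (f N - x) \<in> ell2" using f by blast
  then have "x \<in> ell2" by simp
  moreover have "(\<lambda>n. l2_norm (f n - x)) \<longlonglongrightarrow> 0"
  proof (rule LIMSEQ_I)
    fix e :: real assume "e > 0"
    then obtain N where "\<forall>n\<ge>N. l2_norm (f n - x) \<le> e / 2" using bound[of "e/2"] by auto
    with \<open>e > 0\<close> f \<open>x \<in> ell2\<close> have "\<forall>n\<ge>N. norm (l2_norm (f n - x) - 0) < e" by force
    then show "\<exists>N. \<forall>n\<ge>N. norm (l2_norm (f n - x) - 0) < e" by blast
  qed
  ultimately show thesis using x that by blast
qed

lemma l2_inner_tendsto_left:
  assumes f: "\<And>n. f n \<in> ell2" and x: "x \<in> ell2" and y: "y \<in> ell2"
    and lim: "(\<lambda>n. l2_norm (f n - x)) \<longlonglongrightarrow> 0"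
  shows "(\<lambda>n. l2_inner (f n) y) \<longlonglongrightarrow> l2_inner x y"
proof (rule LIM_zero_cancel, rule Lim_null_comparison)
  show "(\<lambda>n. l2_norm (f n - x) * l2_norm y) \<longlonglongrightarrow> 0"
    using tendsto_mult_right[OF lim, of "l2_norm y"] by simp
  show "\<forall>\<^sub>F n in sequentially. norm (l2_inner (f n) y - l2_inner x y) \<le> l2_norm (f n - x) * l2_norm y"
    using l2_Cauchy_Schwarz[OF ell2_diff[OF f x] y] by (simp add: l2_inner_linear f x y)
qed

lemma l2_inner_tendsto_right:
  assumes f: "\<And>n. f n \<in> ell2" and x: "x \<in> ell2" and y: "y \<in> ell2"
    and lim: "(\<lambda>n. l2_norm (f n - x)) \<longlonglongrightarrow> 0"
  shows "(\<lambda>n. l2_inner y (f n)) \<longlonglongrightarrow> l2_inner y x"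
  using tendsto_cnj[OF l2_inner_tendsto_left[OF assms]] f x y by (simp add: l2_inner_commute[of y])

lemma finite_support_ell2: "(\<And>n. n \<ge> N \<Longrightarrow> x n = 0) \<Longrightarrow> x \<in> ell2" for N :: nat
  unfolding ell2_def mem_Collect_eq by (rule summable_finite[of "{..<N}"]) auto

lemma l2_norm_finite_support_le:
  assumes "\<And>n. n \<ge> N \<Longrightarrow> x n = 0"
  shows "l2_norm x \<le> (\<Sum>n<N. cmod (x n))"
proof -
  have "(\<Sum>n. (cmod (x n))\<^sup>2) = (\<Sum>n<N. (cmod (x n))\<^sup>2)"
    using assms by (intro suminf_finite) auto
  then have "l2_norm x = L2_set (\<lambda>n. cmod (x n)) {..<N}"
    by (simp add: l2_norm_def L2_set_def)
  then show ?thesis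
    by (simp add: L2_set_le_sum)
qed

definition l2_truncate :: "nat \<Rightarrow> (nat \<Rightarrow> complex) \<Rightarrow> nat \<Rightarrow> complex" where
  "l2_truncate N x n = (if n < N then x n else 0)"

lemma l2_truncate_ell2 [simp]: "l2_truncate N x \<in> ell2"
  by (rule finite_support_ell2[of N]) (simp add: l2_truncate_def)

lemma l2_truncate_tendsto:
  assumes x: "x \<in> ell2"
  shows "(\<lambda>N. l2_norm (x - l2_truncate N x)) \<longlonglongrightarrow> 0"
proof -
  let ?f = "\<lambda>n. (cmod (x n))\<^sup>2"
  have f: "summable ?f" using x by (simp add: ell2_def)
  have "l2_norm (x - l2_truncate N x) = sqrt (suminf ?f - sum ?f {..<N})" for N
  proof -
    have "(\<lambda>n. ?f n - (if n \<in> {..<N} then ?f n else 0)) sums (suminf ?f - sum ?f {..<N})"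
      by (intro sums_diff summable_sums f sums_If_finite_set) simp
    also have "(\<lambda>n. ?f n - (if n \<in> {..<N} then ?f n else 0)) = (\<lambda>n. (cmod ((x - l2_truncate N x) n))\<^sup>2)"
      by (auto simp: l2_truncate_def)
    finally show ?thesis by (simp add: l2_norm_def sums_iff)
  qed
  moreover have "(\<lambda>N. sqrt (suminf ?f - sum ?f {..<N})) \<longlonglongrightarrow> sqrt (suminf ?f - suminf ?f)"
    by (intro tendsto_intros summable_LIMSEQ f)
  ultimately show ?thesis by simp
qed

text \<open>\<open>S\<close> will be the set of pivots. Every \<open>b g\<close> vanishes off the
  pivots, so the span of these vectors could not be dense if other coordinates were allowed.\<close>

definition l2_carrier :: "complex set \<Rightarrow> nat set \<Rightarrow> (nat \<Rightarrow> complex) set" where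
  "l2_carrier K S = {x \<in> ell2. (\<forall>n. x n \<in> K) \<and> (\<forall>n. n \<notin> S \<longrightarrow> x n = 0)}"

definition l2_space :: "complex set \<Rightarrow> nat set \<Rightarrow> (complex, nat \<Rightarrow> complex) module" where
  "l2_space K S = \<lparr>carrier = l2_carrier K S, mult = undefined, one = undefined,
     zero = 0, add = (+), smult = scl\<rparr>"

lemma carrier_l2_space: "carrier (l2_space K S) = l2_carrier K S"
  by (simp add: l2_space_def)

lemma l2_carrier_ell2: "x \<in> l2_carrier K S \<Longrightarrow> x \<in> ell2"
  by (simp add: l2_carrier_def)

section \<open>Square-summable sequences over the scalar field form a separable Hilbert
  space\<close>

locale real_or_complex =
  fixes K :: "complex set"
  assumes K: "K = \<real> \<or> K = UNIV"
begin

lemma K_closed [intro, simp]: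
  "0 \<in> K" "1 \<in> K" "of_real r \<in> K" "x \<in> K \<Longrightarrow> y \<in> K \<Longrightarrow> x + y \<in> K"
  "x \<in> K \<Longrightarrow> y \<in> K \<Longrightarrow> x * y \<in> K" "x \<in> K \<Longrightarrow> - x \<in> K"
  "x \<in> K \<Longrightarrow> y \<in> K \<Longrightarrow> x - y \<in> K" "x \<in> K \<Longrightarrow> cnj x \<in> K"
  using K by (auto simp: Reals_cnj_iff)

lemma closed_K: "closed K"
  using K closed_complex_Reals by auto

lemma cring_scalar_ring: "cring (scalar_ring K)"
proof (rule cringI)
  show "abelian_group (scalar_ring K)"
    by (rule abelian_groupI) (auto simp: scalar_ring_def algebra_simps intro!: bexI[of _ "- _"])
  show "Group.comm_monoid (scalar_ring K)"
    by (rule comm_monoidI) (auto simp: scalar_ring_def algebra_simps)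
qed (auto simp: scalar_ring_def algebra_simps)

lemma l2_carrier_closed [intro, simp]:
  "0 \<in> l2_carrier K S"
  "x \<in> l2_carrier K S \<Longrightarrow> y \<in> l2_carrier K S \<Longrightarrow> x + y \<in> l2_carrier K S"
  "x \<in> l2_carrier K S \<Longrightarrow> y \<in> l2_carrier K S \<Longrightarrow> x - y \<in> l2_carrier K S"
  "c \<in> K \<Longrightarrow> x \<in> l2_carrier K S \<Longrightarrow> scl c x \<in> l2_carrier K S"
  by (auto simp: l2_carrier_def)

lemma l2_space_module: "Module.module (scalar_ring K) (l2_space K S)"
proof (rule moduleI[OF cring_scalar_ring])
  show "abelian_group (l2_space K S)"
  proof (rule abelian_groupI)
    fix x assume "x \<in> carrier (l2_space K S)"
    then have "0 - x \<in> carrier (l2_space K S)" by (simp add: l2_space_def del: diff_0)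
    then show "\<exists>y\<in>carrier (l2_space K S). y \<oplus>\<^bsub>l2_space K S\<^esub> x = \<zero>\<^bsub>l2_space K S\<^esub>"
      by (auto simp: l2_space_def intro: bexI[of _ "0 - x"])
  qed (auto simp: l2_space_def add.assoc add.commute)
qed (auto simp: l2_space_def scalar_ring_def fun_eq_iff algebra_simps)

lemma l2_space_minus:
  assumes "x \<in> l2_carrier K S" "y \<in> l2_carrier K S"
  shows "x \<ominus>\<^bsub>l2_space K S\<^esub> y = x - y"
proof -
  interpret M: Module.module "scalar_ring K" "l2_space K S" by (rule l2_space_module)
  have "\<ominus>\<^bsub>l2_space K S\<^esub> y = 0 - y"
    using assms by (intro M.minus_equality) (auto simp: l2_space_def simp del: diff_0)
  then show ?thesis by (simp add: M.minus_eq) (simp add: l2_space_def)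
qed

text \<open>The partial sums lie in \<open>K\<close>, and \<open>K\<close> is closed; this matters
  for real scalars.\<close>

lemma l2_inner_in_K:
  assumes "x \<in> l2_carrier K S" "y \<in> l2_carrier K S"
  shows "l2_inner x y \<in> K"
proof -
  have "(\<Sum>n<N. x n * cnj (y n)) \<in> K" for N
    using assms by (induction N) (auto simp: l2_carrier_def)
  then show ?thesis
    using closed_sequentially[OF closed_K _ l2_inner_sums[of x y, unfolded sums_def]] assms
    by (simp add: l2_carrier_ell2)
qed

lemma l2_space_inner_product_space: "inner_product_space K (l2_space K S) l2_inner"
proof -
  interpret Module.module "scalar_ring K" "l2_space K S" by (rule l2_space_module)
  show ?thesis
  proof unfold_locales
    fix x assume x: "x \<in> carrier (l2_space K S)" "l2_inner x x = 0"
    then have "x \<in> ell2" by (simp add: l2_space_def l2_carrier_ell2)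
    with x show "x = \<zero>\<^bsub>l2_space K S\<^esub>"
      using l2_norm_eq_0_iff[of x] by (simp add: l2_inner_self l2_space_def)
  next
    fix x y assume "x \<in> carrier (l2_space K S)" "y \<in> carrier (l2_space K S)"
    then show "l2_inner x y = cnj (l2_inner y x)"
      by (intro l2_inner_commute) (simp_all add: l2_space_def l2_carrier_ell2)
  qed (simp_all add: l2_space_def l2_inner_in_K l2_inner_self l2_inner_linear l2_carrier_ell2)
qed

lemma l2_ip_dist:
  assumes "x \<in> l2_carrier K S" "y \<in> l2_carrier K S"
  shows "ip_dist (l2_space K S) l2_inner x y = l2_norm (x - y)"
  using assms l2_inner_self[of "x - y"] l2_space_minus[OF assms]
  by (simp add: ip_dist_def l2_carrier_ell2 real_sqrt_abs) (simp add: l2_space_def)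

lemma l2_Metric_space: "Metric_space (carrier (l2_space K S)) (ip_dist (l2_space K S) l2_inner)"
proof
  let ?d = "ip_dist (l2_space K S) l2_inner"
  show "0 \<le> ?d x y" for x y
    by (cases "x \<in> l2_carrier K S \<and> y \<in> l2_carrier K S")
      (auto simp: l2_ip_dist l2_carrier_ell2, auto simp: ip_dist_def carrier_l2_space)
  show "?d x y = ?d y x" for x y
    by (cases "x \<in> l2_carrier K S \<and> y \<in> l2_carrier K S")
      (auto simp: l2_ip_dist l2_norm_minus_commute, auto simp: ip_dist_def carrier_l2_space)
  show "?d x y = 0 \<longleftrightarrow> x = y" if "x \<in> carrier (l2_space K S)" "y \<in> carrier (l2_space K S)" for x y
    using that by (simp add: carrier_l2_space l2_ip_dist l2_norm_eq_0_iff l2_carrier_ell2)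
  show "?d x z \<le> ?d x y + ?d y z" if "x \<in> carrier (l2_space K S)" "y \<in> carrier (l2_space K S)"
    "z \<in> carrier (l2_space K S)" for x y z
    using that by (simp add: carrier_l2_space l2_ip_dist l2_norm_triangle_diff l2_carrier_ell2)
qed

lemma l2_carrier_complete:
  assumes f: "\<And>n. f n \<in> l2_carrier K S"
    and Cauchy: "\<And>e. e > 0 \<Longrightarrow> \<exists>N. \<forall>m\<ge>N. \<forall>n\<ge>N. l2_norm (f m - f n) < e"
  obtains x where "x \<in> l2_carrier K S" "(\<lambda>n. l2_norm (f n - x)) \<longlonglongrightarrow> 0"
proof -
  obtain x where x: "x \<in> ell2" "(\<lambda>n. l2_norm (f n - x)) \<longlonglongrightarrow> 0" "\<And>i. (\<lambda>n. f n i) \<longlonglongrightarrow> x i"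
    using l2_complete[of f] f Cauchy by (metis l2_carrier_ell2)
  have "x i \<in> K" for i
    using closed_sequentially[OF closed_K _ x(3)] f by (auto simp: l2_carrier_def)
  moreover have "x i = 0" if "i \<notin> S" for i
    using x(3)[of i] f that LIMSEQ_unique[OF x(3)[of i], of 0] by (auto simp: l2_carrier_def)
  ultimately show thesis using x that by (auto simp: l2_carrier_def)
qed

lemma l2_space_mcomplete:
  "Metric_space.mcomplete (carrier (l2_space K S)) (ip_dist (l2_space K S) l2_inner)"
proof -
  interpret Metric_space "carrier (l2_space K S)" "ip_dist (l2_space K S) l2_inner"
    by (rule l2_Metric_space)
  show ?thesis
    unfolding mcomplete_def
  proof (intro allI impI)
    fix f assume "MCauchy f"
    then have f: "f n \<in> l2_carrier K S" for n
      unfolding MCauchy_def by (auto simp: carrier_l2_space)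
    have "\<exists>N. \<forall>m\<ge>N. \<forall>n\<ge>N. l2_norm (f m - f n) < e" if "e > 0" for e
      using \<open>MCauchy f\<close> that unfolding MCauchy_def by (simp add: l2_ip_dist f)
    from l2_carrier_complete[OF f this]
    obtain x where x: "x \<in> l2_carrier K S" "(\<lambda>n. l2_norm (f n - x)) \<longlonglongrightarrow> 0" .
    have "limitin mtopology f x sequentially"
      unfolding limit_metric_sequentially
    proof (intro conjI allI impI)
      show "x \<in> carrier (l2_space K S)" by (simp add: x carrier_l2_space)
      fix e :: real assume "e > 0"
      then have "\<exists>N. \<forall>n\<ge>N. norm (l2_norm (f n - x) - 0) < e"
        by (rule LIMSEQ_D[OF x(2)])
      then have "\<exists>N. \<forall>n\<ge>N. l2_norm (f n - x) < e"
        by (simp, meson abs_le_D1 abs_ge_self le_less_trans)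
      then show "\<exists>N. \<forall>n\<ge>N. f n \<in> carrier (l2_space K S) \<and> ip_dist (l2_space K S) l2_inner (f n) x < e"
        using f x by (simp add: carrier_l2_space l2_ip_dist)
    qed
    then show "\<exists>x. limitin mtopology f x sequentially" by (rule exI[of _ x])
  qed
qed

text \<open>The countable dense set consists of finite lists over a countable dense subset of
  \<open>K\<close>, padded with zeros and set to 0 outside \<open>S\<close>. A vector is first
  truncated and then its remaining coordinates are approximated.\<close>

lemma l2_space_separable:
  "separable_space (Metric_space.mtopology (carrier (l2_space K S)) (ip_dist (l2_space K S) l2_inner))"
proof -
  interpret Metric_space "carrier (l2_space K S)" "ip_dist (l2_space K S) l2_inner"
    by (rule l2_Metric_space)
  obtain D where D: "countable D" "D \<subseteq> K" "K \<subseteq> closure D"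
    by (rule separable)
  define F where "F l n = (if n < length l \<and> n \<in> S then l ! n else 0)" for l :: "complex list" and n
  define C where "C = F ` lists D"
  have F: "F l \<in> l2_carrier K S" if "l \<in> lists D" for l
    using that D(2) finite_support_ell2[of "length l" "F l"] nth_mem[of _ l]
    by (auto simp: l2_carrier_def F_def in_lists_conv_set subset_iff)
  have "\<exists>y\<in>C. y \<in> mball x e" if x: "x \<in> l2_carrier K S" and "e > 0" for x e
  proof -
    have "x \<in> ell2" using x by (rule l2_carrier_ell2)
    from LIMSEQ_D[OF l2_truncate_tendsto[OF this], of "e/2"] \<open>e > 0\<close>
    obtain N where N: "norm (l2_norm (x - l2_truncate N x) - 0) < e / 2" by auto
    \<comment> \<open>Each of the \<open>N\<close> coordinates gets this budget, for a total
      strictly below \<open>e / 2\<close>; the \<open>+ 1\<close> keeps the denominator positive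
      when \<open>N = 0\<close>.\<close>
    have "\<forall>n. \<exists>d\<in>D. dist d (x n) < e / (2 * (real N + 1))"
    proof
      fix n
      have "x n \<in> closure D" using x D by (auto simp: l2_carrier_def)
      then show "\<exists>d\<in>D. dist d (x n) < e / (2 * (real N + 1))"
        using \<open>e > 0\<close> unfolding closure_approachable by simp
    qed
    then obtain d where d: "\<And>n. d n \<in> D" "\<And>n. dist (d n) (x n) < e / (2 * (real N + 1))"
      by metis
    define l where "l = map d [0..<N]"
    have l: "l \<in> lists D" using d by (auto simp: l_def)
    have "l2_norm (l2_truncate N x - F l) \<le> (\<Sum>n<N. cmod ((l2_truncate N x - F l) n))"
      by (rule l2_norm_finite_support_le) (simp add: l2_truncate_def F_def l_def)
    also have "\<dots> \<le> (\<Sum>n<N. e / (2 * (real N + 1)))"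
    proof (rule sum_mono)
      fix n assume "n \<in> {..<N}"
      then show "cmod ((l2_truncate N x - F l) n) \<le> e / (2 * (real N + 1))"
        using d(2)[of n] x \<open>e > 0\<close>
        by (auto simp: l2_truncate_def F_def l_def dist_norm norm_minus_commute l2_carrier_def)
    qed
    also have "\<dots> < e / 2"
      using \<open>e > 0\<close> by (simp add: field_simps)
    finally have "l2_norm (x - F l) < e"
      using N l2_norm_triangle_diff[of x "l2_truncate N x" "F l"] \<open>x \<in> ell2\<close> F[OF l]
      by (simp add: l2_carrier_ell2)
    then have "F l \<in> mball x e"
      using x F[OF l] unfolding in_mball by (simp add: carrier_l2_space l2_ip_dist)
    then show ?thesis using l by (auto simp: C_def)
  qed
  moreover have "C \<subseteq> l2_carrier K S" using F by (auto simp: C_def)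
  moreover have "countable C" using D by (simp add: C_def)
  ultimately show ?thesis
    unfolding separable_space_def metric_closure_of topspace_mtopology
    by (intro exI[of _ C]) (auto simp: carrier_l2_space)
qed

lemma l2_separable_Hilbert_space: "separable_Hilbert_space K (l2_space K S) l2_inner"
  unfolding separable_Hilbert_space_def
  using l2_space_inner_product_space l2_space_mcomplete l2_space_separable by blast

end

section \<open>Proper affine actions from equivariant embeddings\<close>

text \<open>Finite linear combinations, built one term at a time, so that statements about the span
  need only a single induction step per added generator.\<close>

inductive l2_span :: "complex set \<Rightarrow> (nat \<Rightarrow> complex) set \<Rightarrow> (nat \<Rightarrow> complex) \<Rightarrow> bool"
  for K B where
  zero: "z = 0 \<Longrightarrow> l2_span K B z"
| step: "l2_span K B x \<Longrightarrow> c \<in> K \<Longrightarrow> y \<in> B \<Longrightarrow> z = x + scl c y \<Longrightarrow> l2_span K B z"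

lemma (in topological_group) eventually_nhdsin_carrier: "\<forall>\<^sub>F h in nhdsin T g. h \<in> carrier G"
  unfolding eventually_nhdsin topspace_eq by (metis openin_topspace topspace_eq)

text \<open>The representation is not part of the data: it is recovered from \<open>b\<close>. By
  \<open>b_invariant\<close> the prescribed images of the \<open>b k\<close> have the same inner
  products as the \<open>b k\<close>, and by \<open>b_dense\<close> these values determine the
  operator.\<close>

locale l2_cocycle = topological_group G T + real_or_complex K
  for G :: "('g, 'c) monoid_scheme" (structure) and T and K +
  fixes S :: "nat set" and b :: "'g \<Rightarrow> nat \<Rightarrow> complex"
  assumes b_carrier: "g \<in> carrier G \<Longrightarrow> b g \<in> l2_carrier K S"
    and b_one: "b \<one> = 0"
    and b_invariant: "\<lbrakk>g \<in> carrier G; h \<in> carrier G; k \<in> carrier G\<rbrakk> \<Longrightarrow>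
      l2_inner (b (g \<otimes> h) - b g) (b (g \<otimes> k) - b g) = l2_inner (b h) (b k)"
    and b_dense: "\<lbrakk>v \<in> l2_carrier K S; e > 0\<rbrakk> \<Longrightarrow>
      \<exists>x. l2_span K (b ` carrier G) x \<and> l2_norm (v - x) < e"
    and b_continuous: "g \<in> carrier G \<Longrightarrow> ((\<lambda>h. l2_norm (b h - b g)) \<longlongrightarrow> 0) (nhdsin T g)"
    and b_proper: "compactin T (T closure_of {g \<in> carrier G. l2_norm (b g) \<le> R})"
begin

lemma b_ell2 [simp]: "g \<in> carrier G \<Longrightarrow> b g \<in> ell2"
  using b_carrier l2_carrier_ell2 by blast

lemma l2_span_carrier: "l2_span K (b ` carrier G) x \<Longrightarrow> x \<in> l2_carrier K S"
proof (induction rule: l2_span.induct)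
  case (step x c y z)
  then have "y \<in> l2_carrier K S" using b_carrier by blast
  then show ?case using step by blast
qed blast

text \<open>If \<open>d\<close> were nonzero, some \<open>x\<close> in the span would satisfy
  \<open>l2_norm (d - x) < l2_norm d\<close>. As \<open>d\<close> is orthogonal to \<open>x\<close>,
  the squared norm of \<open>d\<close> is its inner product with \<open>d - x\<close>, and
  Cauchy-Schwarz gives a contradiction.\<close>

lemma orthogonal_imp_zero:
  assumes d: "d \<in> l2_carrier K S" and orth: "\<And>k. k \<in> carrier G \<Longrightarrow> l2_inner d (b k) = 0"
  shows "d = 0"
proof (rule ccontr)
  assume "d \<noteq> 0"
  have d2: "d \<in> ell2" using d by (rule l2_carrier_ell2)
  then have "l2_norm d > 0"
    using \<open>d \<noteq> 0\<close> l2_norm_eq_0_iff[OF d2] l2_norm_nonneg[OF d2] by linarith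
  then obtain x where x: "l2_span K (b ` carrier G) x" "l2_norm (d - x) < l2_norm d"
    using b_dense[OF d] by blast
  have x2: "x \<in> ell2" using x l2_span_carrier l2_carrier_ell2 by blast
  have "l2_inner d x = 0"
    using x(1)
  proof (induction rule: l2_span.induct)
    case (step x c y z)
    then obtain k where k: "k \<in> carrier G" "y = b k" by blast
    have "x \<in> ell2" using step(1) l2_span_carrier l2_carrier_ell2 by blast
    then show ?case
      unfolding step(4) k(2)
      by (simp only: l2_inner_add_right l2_inner_scl_right d2 orth step.IH k(1) b_ell2 ell2_scl) simp
  next
    case (zero z)
    show ?case unfolding zero by (rule l2_inner_zero)
  qed
  then have "l2_inner d (d - x) = of_real ((l2_norm d)\<^sup>2)"
    by (simp only: l2_inner_diff_right d2 x2 l2_inner_self diff_zero)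
  then have "(l2_norm d)\<^sup>2 = cmod (l2_inner d (d - x))"
    by (simp only: norm_of_real abs_power2)
  also have "\<dots> \<le> l2_norm d * l2_norm (d - x)"
    by (intro l2_Cauchy_Schwarz d2 ell2_diff x2)
  also have "\<dots> < l2_norm d * l2_norm d"
    using x(2) \<open>l2_norm d > 0\<close> by (intro mult_strict_left_mono)
  finally show False by (simp add: power2_eq_square)
qed

text \<open>\<open>w\<close> is the image of \<open>v\<close> under the linear isometry mapping each \<open>b k\<close> to
  \<open>b (g \<otimes> k) - b g\<close>.\<close>

definition intertwines :: "'g \<Rightarrow> (nat \<Rightarrow> complex) \<Rightarrow> (nat \<Rightarrow> complex) \<Rightarrow> bool" where
  "intertwines g v w \<longleftrightarrow> v \<in> l2_carrier K S \<and> w \<in> l2_carrier K S \<and>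
     (\<forall>k\<in>carrier G. l2_inner w (b (g \<otimes> k) - b g) = l2_inner v (b k))"

lemma intertwinesD:
  assumes "intertwines g v w"
  shows "v \<in> l2_carrier K S" "w \<in> l2_carrier K S" "v \<in> ell2" "w \<in> ell2"
    "k \<in> carrier G \<Longrightarrow> l2_inner w (b (g \<otimes> k) - b g) = l2_inner v (b k)"
  using assms by (auto simp: intertwines_def l2_carrier_ell2)

text \<open>The difference is orthogonal to every \<open>b (g \<otimes> k) - b g\<close>. Taking
  \<open>k = inv g\<close> gives orthogonality to \<open>b g\<close>, because
  \<open>b \<one> = 0\<close>; then it is orthogonal to every \<open>b (g \<otimes> k)\<close>, and
  these are all the \<open>b k\<close>.\<close>

lemma intertwines_unique:
  assumes g: "g \<in> carrier G" and w: "intertwines g v w" "intertwines g v w'"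
  shows "w = w'"
proof -
  note w2 = intertwinesD(3,4)[OF w(1)] intertwinesD(4)[OF w(2)]
  have orth: "l2_inner (w - w') (b (g \<otimes> k) - b g) = 0" if "k \<in> carrier G" for k
    using intertwinesD(5)[OF w(1) that] intertwinesD(5)[OF w(2) that] g that w2
    by (simp add: l2_inner_diff_left)
  have orth_g: "l2_inner (w - w') (b g) = 0"
    using orth[of "inv g"] g w2 by (simp add: b_one l2_inner_minus_right)
  have "l2_inner (w - w') (b k) = 0" if "k \<in> carrier G" for k
    using orth[of "inv g \<otimes> k"] orth_g g that w2
    by (simp add: l2_inner_linear inv_solve_left' m_assoc[symmetric])
  then have "w - w' = 0"
    using intertwinesD(2)[OF w(1)] intertwinesD(2)[OF w(2)] by (intro orthogonal_imp_zero) auto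
  then show ?thesis by simp
qed

lemma intertwines_linear:
  assumes "g \<in> carrier G" "intertwines g v w" "intertwines g v' w'"
  shows "intertwines g (v + v') (w + w')" "intertwines g (v - v') (w - w')"
  using intertwinesD[OF assms(2)] intertwinesD[OF assms(3)] assms(1)
  by (simp_all add: intertwines_def l2_inner_add_left l2_inner_diff_left)

lemma intertwines_scl:
  assumes "g \<in> carrier G" "intertwines g v w" "c \<in> K"
  shows "intertwines g (scl c v) (scl c w)"
  using intertwinesD[OF assms(2)] assms(1,3)
  by (simp add: intertwines_def l2_inner_scl_left)

lemma intertwines_b:
  "g \<in> carrier G \<Longrightarrow> h \<in> carrier G \<Longrightarrow> intertwines g (b h) (b (g \<otimes> h) - b g)"
  using b_invariant by (simp add: intertwines_def b_carrier)

text \<open>Whereas \<open>intertwines\<close> tests only against the \<open>b k\<close>, this tests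
  against all intertwined pairs. Applied to the pair itself it yields equality of norms, so it is
  carried along through the construction of the operator.\<close>

definition adjoint_intertwines :: "'g \<Rightarrow> (nat \<Rightarrow> complex) \<Rightarrow> (nat \<Rightarrow> complex) \<Rightarrow> bool" where
  "adjoint_intertwines g v w \<longleftrightarrow> (\<forall>v' w'. intertwines g v' w' \<longrightarrow> l2_inner w' w = l2_inner v' v)"

text \<open>The image is assembled along the derivation of \<open>x\<close>, adding a multiple of
  \<open>b (g \<otimes> h) - b g\<close> for each multiple of \<open>b h\<close>. Independence of
  the derivation is left to \<open>intertwines_unique\<close>.\<close>

lemma span_intertwines:
  assumes g: "g \<in> carrier G" and "l2_span K (b ` carrier G) x"
  shows "\<exists>y. intertwines g x y \<and> adjoint_intertwines g x y"
  using assms(2)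
proof (induction rule: l2_span.induct)
  case zero
  then show ?case
    unfolding intertwines_def adjoint_intertwines_def
    by (intro exI[of _ 0] conjI ballI allI impI) simp_all
next
  case (step x c u z)
  then obtain y h where y: "intertwines g x y" "adjoint_intertwines g x y"
    and h: "h \<in> carrier G" "u = b h" by blast
  let ?w = "b (g \<otimes> h) - b g"
  have "intertwines g (x + scl c u) (y + scl c ?w)"
    unfolding h(2) by (intro intertwines_linear(1) intertwines_scl intertwines_b g h(1) y(1) step(2))
  moreover have "adjoint_intertwines g (x + scl c u) (y + scl c ?w)"
    unfolding adjoint_intertwines_def
  proof (intro allI impI)
    fix v' w' assume "intertwines g v' w'"
    note I = intertwinesD[OF this]
    have "l2_inner w' ?w = l2_inner v' (b h)" by (rule I(5)[OF h(1)])
    moreover have "l2_inner w' y = l2_inner v' x"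
      using y(2) \<open>intertwines g v' w'\<close> by (simp add: adjoint_intertwines_def)
    ultimately show "l2_inner w' (y + scl c ?w) = l2_inner v' (x + scl c u)"
      using I(3,4) intertwinesD(3,4)[OF y(1)] g h
      by (simp add: l2_inner_add_right l2_inner_scl_right)
  qed
  ultimately show ?case using step(4) by blast
qed

lemma intertwines_norm:
  assumes "intertwines g x y" "adjoint_intertwines g x y"
  shows "l2_norm y = l2_norm x"
proof -
  have "l2_inner y y = l2_inner x x"
    using assms by (simp add: adjoint_intertwines_def)
  then have "(l2_norm y)\<^sup>2 = (l2_norm x)\<^sup>2"
    using intertwinesD(3,4)[OF assms(1)] by (simp only: l2_inner_self of_real_eq_iff)
  then show ?thesis
    using intertwinesD(3,4)[OF assms(1)] by (simp add: power2_eq_iff_nonneg)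
qed

text \<open>Approximate \<open>v\<close> by elements of the span. Their images have the same mutual
  distances, so they converge, and both relations pass to the limit by continuity of the inner
  product.\<close>

lemma intertwines_exists:
  assumes g: "g \<in> carrier G" and v: "v \<in> l2_carrier K S"
  shows "\<exists>w. intertwines g v w \<and> adjoint_intertwines g v w"
proof -
  have v2: "v \<in> ell2" using v by (rule l2_carrier_ell2)
  have "\<exists>x. l2_span K (b ` carrier G) x \<and> l2_norm (v - x) < inverse (real (Suc n))" for n
    using b_dense[OF v, of "inverse (real (Suc n))"] by auto
  then obtain x where x: "\<And>n. l2_span K (b ` carrier G) (x n)"
      "\<And>n. l2_norm (v - x n) < inverse (real (Suc n))" by metis
  obtain y where y: "\<And>n. intertwines g (x n) (y n)" "\<And>n. adjoint_intertwines g (x n) (y n)"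
    using span_intertwines[OF g x(1)] by metis
  note x2 [simp] = intertwinesD(3)[OF y(1)] and y2 [simp] = intertwinesD(4)[OF y(1)]
  have x_lim: "(\<lambda>n. l2_norm (x n - v)) \<longlonglongrightarrow> 0"
  proof (rule Lim_null_comparison[OF _ LIMSEQ_inverse_real_of_nat])
    have "norm (l2_norm (x n - v)) \<le> inverse (real (Suc n))" for n
      using x(2)[of n] v2 l2_norm_minus_commute[of v "x n"] by simp
    then show "\<forall>\<^sub>F n in sequentially. norm (l2_norm (x n - v)) \<le> inverse (real (Suc n))" by simp
  qed
  have eq: "l2_norm (y m - y n) = l2_norm (x m - x n)" for m n
  proof (rule intertwines_norm)
    show "intertwines g (x m - x n) (y m - y n)" by (rule intertwines_linear[OF g y(1) y(1)])
    show "adjoint_intertwines g (x m - x n) (y m - y n)"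
      using y(2)[of m] y(2)[of n] unfolding adjoint_intertwines_def
      by (auto simp: l2_inner_diff_right intertwinesD(3,4))
  qed
  have "\<exists>N. \<forall>m\<ge>N. \<forall>n\<ge>N. l2_norm (y m - y n) < e" if "e > 0" for e
  proof -
    from LIMSEQ_D[OF x_lim, of "e/2"] that v2
    obtain N where N: "\<And>n. n \<ge> N \<Longrightarrow> l2_norm (x n - v) < e / 2" by auto
    have "l2_norm (y m - y n) < e" if "m \<ge> N" "n \<ge> N" for m n
      using l2_norm_triangle_diff[of "x m" v "x n"] N[OF that(1)] N[OF that(2)] v2
      by (simp add: eq l2_norm_minus_commute[of v])
    then show ?thesis by blast
  qed
  from l2_carrier_complete[OF intertwinesD(2)[OF y(1)] this]
  obtain w where w: "w \<in> l2_carrier K S" and y_lim: "(\<lambda>n. l2_norm (y n - w)) \<longlonglongrightarrow> 0" .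
  have w2: "w \<in> ell2" using w by (rule l2_carrier_ell2)
  have "intertwines g v w"
    unfolding intertwines_def
  proof (intro conjI ballI v w)
    fix k assume k: "k \<in> carrier G"
    then have "(\<lambda>n. l2_inner (y n) (b (g \<otimes> k) - b g)) \<longlonglongrightarrow> l2_inner w (b (g \<otimes> k) - b g)"
      using g by (intro l2_inner_tendsto_left y_lim w2) auto
    moreover have "(\<lambda>n. l2_inner (x n) (b k)) \<longlonglongrightarrow> l2_inner v (b k)"
      using k by (intro l2_inner_tendsto_left x_lim v2) auto
    ultimately show "l2_inner w (b (g \<otimes> k) - b g) = l2_inner v (b k)"
      using intertwinesD(5)[OF y(1) k] LIMSEQ_unique by simp
  qed
  moreover have "adjoint_intertwines g v w"
    unfolding adjoint_intertwines_def
  proof (intro allI impI)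
    fix v' w' assume I: "intertwines g v' w'"
    have "(\<lambda>n. l2_inner w' (y n)) \<longlonglongrightarrow> l2_inner w' w" "(\<lambda>n. l2_inner v' (x n)) \<longlonglongrightarrow> l2_inner v' v"
      using intertwinesD(3,4)[OF I] by (intro l2_inner_tendsto_right x_lim y_lim v2 w2 x2 y2; simp)+
    moreover have "l2_inner w' (y n) = l2_inner v' (x n)" for n
      using y(2)[of n] I by (simp add: adjoint_intertwines_def)
    ultimately show "l2_inner w' w = l2_inner v' v"
      using LIMSEQ_unique by simp
  qed
  ultimately show ?thesis by blast
qed

section \<open>The linear isometric representation determined by the cocycle\<close>

definition rep_op :: "'g \<Rightarrow> (nat \<Rightarrow> complex) \<Rightarrow> nat \<Rightarrow> complex" where
  "rep_op g v = (THE w. intertwines g v w)"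

text \<open>The algebraic laws of \<open>rep_op\<close> all reduce to this: check that the proposed
  value is intertwined and invoke uniqueness.\<close>

lemma rep_op_eq: "g \<in> carrier G \<Longrightarrow> intertwines g v w \<Longrightarrow> rep_op g v = w"
  unfolding rep_op_def by (rule the_equality) (auto intro: intertwines_unique)

lemma rep_op_intertwines:
  assumes "g \<in> carrier G" "v \<in> l2_carrier K S"
  shows "intertwines g v (rep_op g v)" "adjoint_intertwines g v (rep_op g v)"
proof -
  obtain w where w: "intertwines g v w" "adjoint_intertwines g v w"
    using intertwines_exists[OF assms] by blast
  then show "intertwines g v (rep_op g v)" "adjoint_intertwines g v (rep_op g v)"
    using rep_op_eq[OF assms(1) w(1)] by simp_all
qed

lemma rep_op_carrier: "g \<in> carrier G \<Longrightarrow> v \<in> l2_carrier K S \<Longrightarrow> rep_op g v \<in> l2_carrier K S"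
  using rep_op_intertwines(1) intertwinesD(2) by blast

lemma rep_op_ell2: "g \<in> carrier G \<Longrightarrow> v \<in> l2_carrier K S \<Longrightarrow> rep_op g v \<in> ell2"
  using rep_op_carrier l2_carrier_ell2 by blast

lemma rep_op_norm: "g \<in> carrier G \<Longrightarrow> v \<in> l2_carrier K S \<Longrightarrow> l2_norm (rep_op g v) = l2_norm v"
  using rep_op_intertwines intertwines_norm by blast

lemma rep_op_linear:
  assumes "g \<in> carrier G" "v \<in> l2_carrier K S" "v' \<in> l2_carrier K S"
  shows "rep_op g (v + v') = rep_op g v + rep_op g v'"
    "rep_op g (v - v') = rep_op g v - rep_op g v'"
  by (intro rep_op_eq intertwines_linear rep_op_intertwines(1) assms)+

lemma rep_op_scl:
  assumes "g \<in> carrier G" "v \<in> l2_carrier K S" "c \<in> K"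
  shows "rep_op g (scl c v) = scl c (rep_op g v)"
  by (intro rep_op_eq intertwines_scl rep_op_intertwines(1) assms)

lemma rep_op_b: "g \<in> carrier G \<Longrightarrow> h \<in> carrier G \<Longrightarrow> rep_op g (b h) = b (g \<otimes> h) - b g"
  by (intro rep_op_eq intertwines_b)

lemma rep_op_one: "v \<in> l2_carrier K S \<Longrightarrow> rep_op \<one> v = v"
  by (intro rep_op_eq) (auto simp: intertwines_def b_one)

text \<open>The vector \<open>b (g \<otimes> h \<otimes> k) - b (g \<otimes> h)\<close> is a
  difference of two vectors of the form \<open>b (g \<otimes> l) - b g\<close>, with
  \<open>l = h \<otimes> k\<close> and \<open>l = h\<close>. So the relation for \<open>g\<close>
  removes \<open>g\<close>, and the relation for \<open>h\<close> then removes
  \<open>h\<close>.\<close>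

lemma rep_op_mult:
  assumes g: "g \<in> carrier G" and h: "h \<in> carrier G" and v: "v \<in> l2_carrier K S"
  shows "rep_op (g \<otimes> h) v = rep_op g (rep_op h v)"
proof (rule rep_op_eq)
  let ?w = "rep_op g (rep_op h v)"
  note I = rep_op_intertwines(1)[OF h v] rep_op_intertwines(1)[OF g rep_op_carrier[OF h v]]
  show "intertwines (g \<otimes> h) v ?w"
    unfolding intertwines_def
  proof (intro conjI ballI v intertwinesD(2)[OF I(2)])
    fix k assume k: "k \<in> carrier G"
    have "b (g \<otimes> h \<otimes> k) - b (g \<otimes> h) = (b (g \<otimes> (h \<otimes> k)) - b g) - (b (g \<otimes> h) - b g)"
      using g h k by (simp add: m_assoc)
    then have "l2_inner ?w (b (g \<otimes> h \<otimes> k) - b (g \<otimes> h)) =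
        l2_inner ?w (b (g \<otimes> (h \<otimes> k)) - b g) - l2_inner ?w (b (g \<otimes> h) - b g)"
      using g h k intertwinesD(4)[OF I(2)] by (simp only: l2_inner_diff_right ell2_diff b_ell2 m_closed)
    also have "\<dots> = l2_inner (rep_op h v) (b (h \<otimes> k)) - l2_inner (rep_op h v) (b h)"
      using g h k by (simp only: intertwinesD(5)[OF I(2)] m_closed)
    also have "\<dots> = l2_inner (rep_op h v) (b (h \<otimes> k) - b h)"
      using g h k intertwinesD(4)[OF I(1)] by (simp only: l2_inner_diff_right b_ell2 m_closed)
    also have "\<dots> = l2_inner v (b k)"
      by (rule intertwinesD(5)[OF I(1) k])
    finally show "l2_inner ?w (b (g \<otimes> h \<otimes> k) - b (g \<otimes> h)) = l2_inner v (b k)" .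
  qed
qed (use g h in simp)

text \<open>An isometry of an infinite-dimensional space can fail to be onto; here surjectivity
  comes from the group inverse.\<close>

lemma rep_op_inverse:
  assumes "g \<in> carrier G" "v \<in> l2_carrier K S"
  shows "rep_op (inv g) (rep_op g v) = v" "rep_op g (rep_op (inv g) v) = v"
  using assms by (simp_all add: rep_op_one flip: rep_op_mult)

section \<open>Strong continuity of the representation\<close>

lemma filterlim_right_translation:
  assumes g: "g \<in> carrier G" and k: "k \<in> carrier G"
  shows "filterlim (\<lambda>h. h \<otimes> k) (nhdsin T (g \<otimes> k)) (nhdsin T g)"
  unfolding filterlim_iff
proof (intro allI impI)
  have "continuous_map T (prod_topology T T) (\<lambda>h. (h, k))"
    using k by (simp add: continuous_map_pairwise o_def topspace_eq)
  from continuous_map_compose[OF this continuous_mult]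
  have cont: "continuous_map T T (\<lambda>h. h \<otimes> k)"
    by (simp add: o_def)
  fix P assume "eventually P (nhdsin T (g \<otimes> k))"
  then obtain U where U: "openin T U" "g \<otimes> k \<in> U" "\<forall>x\<in>U. P x"
    using g k by (auto simp: eventually_nhdsin topspace_eq)
  show "\<forall>\<^sub>F h in nhdsin T g. P (h \<otimes> k)"
    unfolding eventually_nhdsin
    using openin_continuous_map_preimage[OF cont U(1)] U(2,3) g
    by (intro disjI2 exI[of _ "{x \<in> topspace T. x \<otimes> k \<in> U}"]) (auto simp: topspace_eq)
qed

text \<open>Since \<open>rep_op h (b k) = b (h \<otimes> k) - b h\<close>, continuity of
  \<open>b\<close> at \<open>g \<otimes> k\<close> and at \<open>g\<close> suffices.\<close>

lemma rep_op_b_continuous: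
  assumes g: "g \<in> carrier G" and k: "k \<in> carrier G"
  shows "((\<lambda>h. l2_norm (rep_op h (b k) - rep_op g (b k))) \<longlongrightarrow> 0) (nhdsin T g)"
proof (rule Lim_null_comparison)
  have "((\<lambda>h. l2_norm (b (h \<otimes> k) - b (g \<otimes> k))) \<longlongrightarrow> 0) (nhdsin T g)"
    using filterlim_compose[OF b_continuous filterlim_right_translation[OF g k]] g k by simp
  from tendsto_add[OF this b_continuous[OF g]]
  show "((\<lambda>h. l2_norm (b (h \<otimes> k) - b (g \<otimes> k)) + l2_norm (b h - b g)) \<longlongrightarrow> 0) (nhdsin T g)"
    by simp
  show "\<forall>\<^sub>F h in nhdsin T g. norm (l2_norm (rep_op h (b k) - rep_op g (b k)))
      \<le> l2_norm (b (h \<otimes> k) - b (g \<otimes> k)) + l2_norm (b h - b g)"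
    using eventually_nhdsin_carrier
  proof eventually_elim
    case (elim h)
    have "rep_op h (b k) - rep_op g (b k) = (b (h \<otimes> k) - b (g \<otimes> k)) - (b h - b g)"
      using elim g k by (simp add: rep_op_b)
    then show ?case
      using l2_norm_triangle_diff[of "b (h \<otimes> k) - b (g \<otimes> k)" 0 "b h - b g"] elim g k
        l2_norm_minus_commute[of 0 "b h - b g"] l2_norm_nonneg[of "rep_op h (b k) - rep_op g (b k)"]
      by simp
  qed
qed

lemma rep_op_span_continuous:
  assumes g: "g \<in> carrier G" and x: "l2_span K (b ` carrier G) x"
  shows "((\<lambda>h. l2_norm (rep_op h x - rep_op g x)) \<longlongrightarrow> 0) (nhdsin T g)"
  using x
proof (induction rule: l2_span.induct)
  case (zero z)
  show ?case
    unfolding zero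
  proof (rule Lim_null_comparison[OF _ tendsto_const])
    show "\<forall>\<^sub>F h in nhdsin T g. norm (l2_norm (rep_op h 0 - rep_op g 0)) \<le> 0"
      using eventually_nhdsin_carrier
    proof eventually_elim
      case (elim h)
      have "rep_op h' 0 = 0" if "h' \<in> carrier G" for h'
        using rep_op_linear(2)[OF that, of 0 0] by simp
      then show ?case using elim g by simp
    qed
  qed
next
  case (step x c y z)
  then obtain k where k: "k \<in> carrier G" "y = b k" by blast
  note x = l2_span_carrier[OF step(1)]
  let ?D = "\<lambda>h x. rep_op h x - rep_op g x"
  have IH: "((\<lambda>h. l2_norm (?D h x)) \<longlongrightarrow> 0) (nhdsin T g)"
    using step.IH by (simp add: fun_diff_def)
  show ?case
    unfolding step(4) k(2)
  proof (rule Lim_null_comparison)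
    show "((\<lambda>h. l2_norm (?D h x) + cmod c * l2_norm (?D h (b k))) \<longlongrightarrow> 0) (nhdsin T g)"
      using tendsto_add[OF IH tendsto_mult_left[OF rep_op_b_continuous[OF g k(1)], of "cmod c"]]
      by simp
    show "\<forall>\<^sub>F h in nhdsin T g. norm (l2_norm (?D h (x + scl c (b k))))
        \<le> l2_norm (?D h x) + cmod c * l2_norm (?D h (b k))"
      using eventually_nhdsin_carrier
    proof eventually_elim
      case (elim h)
      note bk = b_carrier[OF k(1)]
      have D: "?D h v \<in> ell2" if "v \<in> l2_carrier K S" for v
        using that elim g rep_op_carrier l2_carrier_ell2 by blast
      have "rep_op h' (x + scl c (b k)) = rep_op h' x + scl c (rep_op h' (b k))"
        if "h' \<in> carrier G" for h'
        using that x bk step(2) by (simp add: rep_op_linear rep_op_scl)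
      then have "?D h (x + scl c (b k)) = ?D h x + scl c (?D h (b k))"
        using elim g by (simp add: fun_eq_iff algebra_simps)
      then show ?case
        using l2_norm_triangle[OF D[OF x] ell2_scl[OF D[OF bk], of c]] D[OF x] D[OF bk]
        by (simp add: l2_norm_scl)
    qed
  qed
qed

text \<open>An \<open>e / 3\<close> argument: replacing \<open>v\<close> by a nearby
  \<open>x\<close> of the span costs the same for every group element, as all
  \<open>rep_op h\<close> are isometries.\<close>

lemma rep_op_continuous:
  assumes g: "g \<in> carrier G" and v: "v \<in> l2_carrier K S"
  shows "((\<lambda>h. l2_norm (rep_op h v - rep_op g v)) \<longlongrightarrow> 0) (nhdsin T g)"
proof (rule tendstoI)
  fix e :: real assume "e > 0"
  then obtain x where x: "l2_span K (b ` carrier G) x" "l2_norm (v - x) < e / 3"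
    using b_dense[OF v, of "e/3"] by auto
  have xc: "x \<in> l2_carrier K S" using x(1) by (rule l2_span_carrier)
  have "\<forall>\<^sub>F h in nhdsin T g. dist (l2_norm (rep_op h x - rep_op g x)) 0 < e / 3"
    using tendstoD[OF rep_op_span_continuous[OF g x(1)], of "e/3"] \<open>e > 0\<close> by simp
  with eventually_nhdsin_carrier
  show "\<forall>\<^sub>F h in nhdsin T g. dist (l2_norm (rep_op h v - rep_op g v)) 0 < e"
  proof eventually_elim
    case (elim h)
    have R: "rep_op h' u \<in> ell2" if "u \<in> l2_carrier K S" "h' \<in> carrier G" for u h'
      using rep_op_carrier[OF that(2,1)] by (rule l2_carrier_ell2)
    have "l2_norm (rep_op h' v - rep_op h' x) = l2_norm (v - x)" if "h' \<in> carrier G" for h'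
      using rep_op_norm[OF that, of "v - x"] rep_op_linear(2)[OF that v xc] v xc by simp
    then have "l2_norm (rep_op h v - rep_op h x) < e / 3" "l2_norm (rep_op g x - rep_op g v) < e / 3"
      using x(2) elim g l2_norm_minus_commute[of "rep_op g x"] by simp_all
    moreover have "l2_norm (rep_op h v - rep_op g v) \<le> l2_norm (rep_op h v - rep_op h x) +
        l2_norm (rep_op h x - rep_op g x) + l2_norm (rep_op g x - rep_op g v)"
      using l2_norm_triangle_diff[of "rep_op h v" "rep_op h x" "rep_op g v"]
        l2_norm_triangle_diff[of "rep_op h x" "rep_op g x" "rep_op g v"] R v xc elim g by simp
    moreover have "0 \<le> l2_norm (rep_op h v - rep_op g v)" "0 \<le> l2_norm (rep_op h x - rep_op g x)"
      using R v xc elim g by simp_all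
    ultimately show ?case
      using elim(2) unfolding dist_real_def by simp
  qed
qed

section \<open>The affine action and its properness\<close>

definition action :: "'g \<Rightarrow> (nat \<Rightarrow> complex) \<Rightarrow> nat \<Rightarrow> complex" where
  "action g v = rep_op g v + b g"

lemma action_carrier: "g \<in> carrier G \<Longrightarrow> v \<in> l2_carrier K S \<Longrightarrow> action g v \<in> l2_carrier K S"
  unfolding action_def by (intro l2_carrier_closed rep_op_carrier b_carrier)

lemma action_continuous:
  assumes v: "v \<in> l2_carrier K S"
  shows "continuous_map T
    (Metric_space.mtopology (carrier (l2_space K S)) (ip_dist (l2_space K S) l2_inner)) (\<lambda>g. action g v)"
proof -
  interpret Metric_space "carrier (l2_space K S)" "ip_dist (l2_space K S) l2_inner"
    by (rule l2_Metric_space)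
  show ?thesis
    unfolding continuous_map_to_metric
  proof (intro ballI allI impI)
    fix g and e :: real assume "g \<in> topspace T" "e > 0"
    then have g: "g \<in> carrier G" by (simp add: topspace_eq)
    have "((\<lambda>h. l2_norm (rep_op h v - rep_op g v) + l2_norm (b h - b g)) \<longlongrightarrow> 0) (nhdsin T g)"
      using tendsto_add[OF rep_op_continuous[OF g v] b_continuous[OF g]] by simp
    then have "\<forall>\<^sub>F h in nhdsin T g. dist (l2_norm (rep_op h v - rep_op g v) + l2_norm (b h - b g)) 0 < e"
      by (rule tendstoD) fact
    with eventually_nhdsin_carrier
    have "\<forall>\<^sub>F h in nhdsin T g. action h v \<in> mball (action g v) e"
    proof eventually_elim
      case (elim h)
      have "action h v - action g v = (rep_op h v - rep_op g v) + (b h - b g)"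
        by (simp add: action_def)
      then have "l2_norm (action h v - action g v) \<le> l2_norm (rep_op h v - rep_op g v) + l2_norm (b h - b g)"
        using l2_norm_triangle[of "rep_op h v - rep_op g v" "b h - b g"] elim(1) g v
        by (simp add: rep_op_ell2)
      then show ?case
        unfolding in_mball using elim g v l2_norm_minus_commute[of "action g v"]
        by (simp add: carrier_l2_space action_carrier l2_ip_dist)
    qed
    then show "\<exists>U. openin T U \<and> g \<in> U \<and> (\<forall>h\<in>U. action h v \<in> mball (action g v) e)"
      using \<open>g \<in> topspace T\<close> unfolding eventually_nhdsin by blast
  qed
qed

lemma action_affine_isometric:
  "affine_isometric_action G T K (l2_space K S) (ip_dist (l2_space K S) l2_inner) action"
  unfolding affine_isometric_action_def
proof (intro conjI exI)
  show "\<forall>g\<in>carrier G. \<forall>v\<in>carrier (l2_space K S). action g v = rep_op g v \<oplus>\<^bsub>l2_space K S\<^esub> b g"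
    by (simp add: action_def l2_space_def)
  show "\<forall>v\<in>carrier (l2_space K S). continuous_map T
     (Metric_space.mtopology (carrier (l2_space K S)) (ip_dist (l2_space K S) l2_inner)) (\<lambda>g. action g v)"
    using action_continuous by (simp only: carrier_l2_space) blast
  show "cocycle G (l2_space K S) rep_op b"
    by (auto simp: cocycle_def carrier_l2_space b_carrier rep_op_b) (simp add: l2_space_def)
  show "isometric_representation G K (l2_space K S) (ip_dist (l2_space K S) l2_inner) rep_op"
    unfolding isometric_representation_def carrier_l2_space
  proof (intro conjI ballI)
    fix g assume g: "g \<in> carrier G"
    show "linear_isometry K (l2_space K S) (ip_dist (l2_space K S) l2_inner) (rep_op g)"
      unfolding linear_isometry_def carrier_l2_space
    proof (intro conjI ballI)
      show "bij_betw (rep_op g) (l2_carrier K S) (l2_carrier K S)"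
        using g by (intro bij_betwI[where g = "rep_op (inv g)"])
          (simp_all add: rep_op_inverse rep_op_carrier)
      fix x y assume xy: "x \<in> l2_carrier K S" "y \<in> l2_carrier K S"
      show "rep_op g (x \<oplus>\<^bsub>l2_space K S\<^esub> y) = rep_op g x \<oplus>\<^bsub>l2_space K S\<^esub> rep_op g y"
        using rep_op_linear(1)[OF g xy] by (simp add: l2_space_def)
      have "l2_norm (rep_op g x - rep_op g y) = l2_norm (x - y)"
        using rep_op_norm[OF g, of "x - y"] rep_op_linear(2)[OF g xy] xy by simp
      then show "ip_dist (l2_space K S) l2_inner (rep_op g x) (rep_op g y) = ip_dist (l2_space K S) l2_inner x y"
        using g xy by (simp add: l2_ip_dist rep_op_carrier)
    next
      fix c x assume "c \<in> K" "x \<in> l2_carrier K S"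
      then show "rep_op g (c \<odot>\<^bsub>l2_space K S\<^esub> x) = c \<odot>\<^bsub>l2_space K S\<^esub> rep_op g x"
        using rep_op_scl[OF g] by (simp add: l2_space_def)
    qed
  qed (simp_all add: rep_op_one rep_op_mult)
qed

lemma action_proper:
  "proper_action G T (carrier (l2_space K S)) (ip_dist (l2_space K S) l2_inner) action"
proof -
  interpret Metric_space "carrier (l2_space K S)" "ip_dist (l2_space K S) l2_inner"
    by (rule l2_Metric_space)
  show ?thesis
    unfolding proper_action_def
  proof (intro allI impI)
    fix U assume "mbounded U"
    then obtain a B where U: "U \<subseteq> mcball a B" by (auto simp: mbounded_def)
    have bound: "u \<in> l2_carrier K S \<and> l2_norm u \<le> l2_norm a + B" if "u \<in> U" for u
    proof -
      have "u \<in> mcball a B" using U that by blast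
      then have *: "a \<in> l2_carrier K S" "u \<in> l2_carrier K S" "l2_norm (a - u) \<le> B"
        unfolding in_mcball by (auto simp: carrier_l2_space l2_ip_dist)
      then show ?thesis
        using l2_norm_triangle[of "u - a" a] l2_norm_minus_commute[of u a]
        by (simp add: l2_carrier_ell2)
    qed
    \<comment> \<open>If \<open>u\<close> and \<open>action g u\<close> both lie in
      \<open>U\<close>, then \<open>b g = action g u - rep_op g u\<close> is a difference of two
      vectors of norm at most \<open>l2_norm a + B\<close>.\<close>
    let ?R = "2 * (l2_norm a + B)"
    have "{g \<in> carrier G. action g ` U \<inter> U \<noteq> {}} \<subseteq> {g \<in> carrier G. l2_norm (b g) \<le> ?R}"
    proof
      fix g assume "g \<in> {g \<in> carrier G. action g ` U \<inter> U \<noteq> {}}"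
      then obtain u where g: "g \<in> carrier G" and "u \<in> U" "action g u \<in> U" by blast
      note u = bound[OF \<open>u \<in> U\<close>] and gu = bound[OF \<open>action g u \<in> U\<close>]
      have "b g = action g u - rep_op g u" by (simp add: action_def)
      then have "l2_norm (b g) \<le> l2_norm (action g u) + l2_norm (rep_op g u)"
        using l2_norm_triangle_diff[of "action g u" 0 "rep_op g u"] g u gu
          l2_norm_minus_commute[of 0 "rep_op g u"]
          l2_carrier_ell2[OF conjunct1[OF gu]]
        by (simp add: rep_op_ell2)
      then show "g \<in> {g \<in> carrier G. l2_norm (b g) \<le> ?R}"
        using rep_op_norm[OF g, of u] u gu g by simp
    qed
    then have "T closure_of {g \<in> carrier G. action g ` U \<inter> U \<noteq> {}} \<subseteq>
        T closure_of {g \<in> carrier G. l2_norm (b g) \<le> ?R}"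
      by (rule closure_of_mono)
    then show "compactin T (T closure_of {g \<in> carrier G. action g ` U \<inter> U \<noteq> {}})"
      using closed_compactin[OF b_proper] closedin_closure_of by blast
  qed
qed

theorem a_T_menable: "a_T_menable K G T"
  unfolding a_T_menable_def admits_proper_affine_isometric_action_def
  using l2_separable_Hilbert_space action_affine_isometric action_proper by blast

end

section \<open>Proper affine actions from conditionally negative definite kernels\<close>

lemma l2_span_add:
  assumes x: "l2_span K B x" and y: "l2_span K B y"
  shows "l2_span K B (x + y)"
  using y
proof (induction rule: l2_span.induct)
  case (zero z)
  then show ?case using x by (simp add: zero_fun_def plus_fun_def)
next
  case (step u c w z)
  have "x + z = (x + u) + scl c w" unfolding step(4) by (simp add: add.assoc)
  moreover have "l2_span K B (x + u)" using step.IH by (simp add: plus_fun_def)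
  ultimately show ?case using l2_span.step step(2,3) by metis
qed

lemma (in real_or_complex) l2_span_scl:
  assumes x: "l2_span K B x" and a: "a \<in> K"
  shows "l2_span K B (scl a x)"
  using x
proof (induction rule: l2_span.induct)
  case (zero z)
  have "scl a z = 0" unfolding zero by (simp add: fun_eq_iff)
  then show ?case by (rule l2_span.zero)
next
  case (step u c w z)
  have "scl a z = scl a u + scl (a * c) w"
    unfolding step(4) by (simp add: fun_eq_iff algebra_simps)
  then show ?case using l2_span.step[OF step.IH _ step(3)] a step(2) by blast
qed

lemma l2_span_sum: "(\<And>i. i \<in> F \<Longrightarrow> l2_span K B (f i)) \<Longrightarrow> l2_span K B (sum f F)"
  by (induction F rule: infinite_finite_induct) (auto intro: l2_span.zero l2_span_add)

definition l2_unit :: "nat \<Rightarrow> nat \<Rightarrow> complex" where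
  "l2_unit n m = (if m = n then 1 else 0)"

lemma l2_truncate_eq_sum: "l2_truncate N x = (\<Sum>n<N. scl (x n) (l2_unit n))"
proof (induction N)
  case 0
  show ?case by (simp add: l2_truncate_def fun_eq_iff)
next
  case (Suc N)
  have "l2_truncate (Suc N) x = l2_truncate N x + scl (x N) (l2_unit N)"
    by (auto simp: l2_truncate_def fun_eq_iff l2_unit_def less_Suc_eq)
  then show ?case using Suc.IH by simp
qed

lemma (in real_or_complex) l2_truncate_in_span:
  assumes "\<And>n. n < N \<Longrightarrow> n \<in> S \<Longrightarrow> l2_span K B (l2_unit n)"
    and x: "\<And>n. x n \<in> K" "\<And>n. n \<notin> S \<Longrightarrow> x n = 0"
  shows "l2_span K B (l2_truncate N x)"
  unfolding l2_truncate_eq_sum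
proof (rule l2_span_sum)
  fix n assume n: "n \<in> {..<N}"
  show "l2_span K B (scl (x n) (l2_unit n))"
  proof (cases "n \<in> S")
    case True
    then show ?thesis using assms n by (intro l2_span_scl) auto
  next
    case False
    then have "scl (x n) (l2_unit n) = 0" using x(2) by (simp add: fun_eq_iff)
    then show ?thesis by (rule l2_span.zero)
  qed
qed

text \<open>The row of \<open>q n\<close> in the Cholesky factor ends at the \<open>n\<close>-th column, so that the
  unit vectors at the pivots are found successively by back substitution.\<close>

lemma (in real_or_complex) l2_unit_in_cholesky_span:
  fixes X and \<kappa> :: "'a \<Rightarrow> 'a \<Rightarrow> real" and q :: "nat \<Rightarrow> 'a"
  assumes psd: "psd_kernel X \<kappa>" and q: "\<And>n. q n \<in> X"
    and b: "\<And>x n. b x n = complex_of_real (cholesky \<kappa> q x n)"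
    and n: "n \<in> pivots \<kappa> q"
  shows "l2_span K (b ` X) (l2_unit n)"
  using n
proof (induction n rule: less_induct)
  case (less n)
  let ?S = "l2_span K (b ` X)"
  have bS: "?S (b (q n))"
    using l2_span.step[OF l2_span.zero[OF refl] K_closed(2), of "b (q n)" "b ` X" "b (q n)"] q
    by (simp add: scl_def)
  have tS: "?S (l2_truncate n (b (q n)))"
    by (rule l2_truncate_in_span[of n "pivots \<kappa> q"]) (auto simp: b cholesky_eq_0 less.IH)
  have nz: "b (q n) n \<noteq> 0"
    using cholesky_diag[OF psd q less.prems] by (simp add: b)
  \<comment> \<open>Exhibits the scalar as a real number, hence as an element of \<open>K\<close> in
    either case.\<close>
  have inv: "inverse (b (q n) n) = of_real (inverse (cholesky \<kappa> q (q n) n))"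
    by (simp add: b)
  have "l2_unit n = scl (inverse (b (q n) n)) (b (q n) + scl (- 1) (l2_truncate n (b (q n))))"
  proof
    fix m
    show "l2_unit n m = scl (inverse (b (q n) n)) (b (q n) + scl (- 1) (l2_truncate n (b (q n)))) m"
      using nz cholesky_above[OF psd q, of n m]
      by (cases m n rule: linorder_cases) (simp_all add: l2_unit_def l2_truncate_def b)
  qed
  moreover have "?S (scl (inverse (b (q n) n)) (b (q n) + scl (- 1) (l2_truncate n (b (q n)))))"
    using bS tS K_closed(6)[OF K_closed(2)] unfolding inv
    by (intro l2_span_scl l2_span_add K_closed(3))
  ultimately show ?case by (simp only:)
qed

theorem (in topological_group) a_T_menable_if_proper_kernel:
  fixes k :: "'g \<Rightarrow> 'g \<Rightarrow> real"
  assumes K: "K = \<real> \<or> K = UNIV" and sc: "second_countable T"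
    and psd: "psd_kernel (carrier G) (\<lambda>g h. k g \<one> + k h \<one> - k g h)"
    and self: "\<And>g. g \<in> carrier G \<Longrightarrow> k g g = 0"
    and invariant: "\<And>s g h. \<lbrakk>s \<in> carrier G; g \<in> carrier G; h \<in> carrier G\<rbrakk> \<Longrightarrow>
      k (s \<otimes> g) (s \<otimes> h) = k g h"
    and cont: "\<And>g. g \<in> carrier G \<Longrightarrow> ((\<lambda>h. k h g) \<longlongrightarrow> 0) (nhdsin T g)"
    and proper: "\<And>R. compactin T (T closure_of {g \<in> carrier G. k g \<one> \<le> R})"
  shows "a_T_menable K G T"
proof -
  interpret real_or_complex K by unfold_locales (rule K)
  define \<kappa> where "\<kappa> g h = k g \<one> + k h \<one> - k g h" for g h
  have psd: "psd_kernel (carrier G) \<kappa>" using psd unfolding \<kappa>_def[abs_def] .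
  have sym: "k g h = k h g" if "g \<in> carrier G" "h \<in> carrier G" for g h
    using psd_kernel_sym[OF psd that] by (simp add: \<kappa>_def)
  have dist: "\<kappa> g g - 2 * \<kappa> g h + \<kappa> h h = 2 * k g h" if "g \<in> carrier G" "h \<in> carrier G" for g h
    using that by (simp add: \<kappa>_def self)
  obtain C where C: "countable C" "C \<subseteq> carrier G" "T closure_of C = carrier G"
    using second_countable_imp_separable_space[OF sc] topspace_eq
    unfolding separable_space_def by auto
  then have "C \<noteq> {}" by auto
  \<comment> \<open>Repetitions, as for finite \<open>C\<close>, are harmless: a repeated point has
    a zero pivot.\<close>
  define q where "q = from_nat_into C"
  have q: "q n \<in> carrier G" for n
    using from_nat_into[OF \<open>C \<noteq> {}\<close>, of n] C(2) by (auto simp: q_def)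
  \<comment> \<open>By \<open>dist\<close> the left-hand side is \<open>2 * k g (q m)\<close>.
    Continuity of \<open>k\<close> thus turns topological density of \<open>C\<close> into density
    for the distance induced by the kernel.\<close>
  have dense: "\<exists>m. \<kappa> g g - 2 * \<kappa> g (q m) + \<kappa> (q m) (q m) < e"
    if g: "g \<in> carrier G" and "e > 0" for g e
  proof -
    have "\<forall>\<^sub>F h in nhdsin T g. dist (k h g) 0 < e / 2"
      using tendstoD[OF cont[OF g], of "e/2"] \<open>e > 0\<close> by simp
    then obtain U where U: "openin T U" "g \<in> U" "\<And>h. h \<in> U \<Longrightarrow> dist (k h g) 0 < e / 2"
      using g by (auto simp: eventually_nhdsin topspace_eq)
    then obtain c where "c \<in> C" "c \<in> U"
      using g C(3) unfolding in_closure_of set_eq_iff by blast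
    moreover obtain m where "q m = c"
      using from_nat_into_surj[OF C(1) \<open>c \<in> C\<close>] by (auto simp: q_def)
    ultimately show ?thesis
      using U(3)[of c] dist[OF g, of c] sym[OF g, of c] C(2)
      by (intro exI[of _ m]) auto
  qed
  define b where "b g n = complex_of_real (cholesky \<kappa> q g n)" for g n
  have sums: "(\<lambda>n. cholesky \<kappa> q g n * cholesky \<kappa> q h n) sums \<kappa> g h"
    if "g \<in> carrier G" "h \<in> carrier G" for g h
    by (rule cholesky_sums[OF psd q that dense])
  have b_carrier: "b g \<in> l2_carrier K (pivots \<kappa> q)" if "g \<in> carrier G" for g
    using sums_summable[OF sums[OF that that]]
    by (simp add: l2_carrier_def ell2_def b_def cholesky_eq_0 power2_eq_square)
  note b2 = l2_carrier_ell2[OF b_carrier]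
  have inner: "l2_inner (b g) (b h) = of_real (\<kappa> g h)" if "g \<in> carrier G" "h \<in> carrier G" for g h
    using sums_unique[OF sums_of_real[OF sums[OF that], where 'a = complex]]
    by (simp add: l2_inner_def b_def)
  have norm: "l2_norm (b g - b h) = sqrt (2 * k g h)" if "g \<in> carrier G" "h \<in> carrier G" for g h
  proof -
    have "complex_of_real ((l2_norm (b g - b h))\<^sup>2) = of_real (\<kappa> g g - 2 * \<kappa> g h + \<kappa> h h)"
      using that psd_kernel_sym[OF psd that]
      by (simp only: l2_inner_self[symmetric] ell2_diff b2 l2_inner_diff_left l2_inner_diff_right inner) simp
    then have "(l2_norm (b g - b h))\<^sup>2 = 2 * k g h"
      using that by (simp only: of_real_eq_iff dist)
    then show ?thesis
      using l2_norm_nonneg[OF ell2_diff[OF b2 b2]] that by (metis real_sqrt_unique)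
  qed
  have b_one: "b \<one> = 0"
    using inner[of \<one> \<one>] l2_inner_self[OF b2, of \<one>] l2_norm_eq_0_iff[OF b2, of \<one>]
    by (simp add: \<kappa>_def self)
  interpret l2_cocycle G T K "pivots \<kappa> q" b
  proof unfold_locales
    show "b g \<in> l2_carrier K (pivots \<kappa> q)" if "g \<in> carrier G" for g using that by (rule b_carrier)
    show "b \<one> = 0" by (rule b_one)
    show "l2_inner (b (g \<otimes> h) - b g) (b (g \<otimes> l) - b g) = l2_inner (b h) (b l)"
      if "g \<in> carrier G" "h \<in> carrier G" "l \<in> carrier G" for g h l
    proof -
      \<comment> \<open>Invariance applies after reading \<open>g\<close> as
        \<open>g \<otimes> \<one>\<close>.\<close>
      have "k (g \<otimes> h) g = k h \<one>" "k g (g \<otimes> l) = k l \<one>"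
        using invariant[of g h \<one>] invariant[of g \<one> l] sym[of \<one> l] that by simp_all
      then have "\<kappa> (g \<otimes> h) (g \<otimes> l) - \<kappa> (g \<otimes> h) g - (\<kappa> g (g \<otimes> l) - \<kappa> g g) = \<kappa> h l"
        using that by (simp add: \<kappa>_def invariant self)
      then show ?thesis
        using that by (simp add: l2_inner_diff_left l2_inner_diff_right b2 inner flip: of_real_diff)
    qed
    show "\<exists>x. l2_span K (b ` carrier G) x \<and> l2_norm (v - x) < e"
      if v: "v \<in> l2_carrier K (pivots \<kappa> q)" and "e > 0" for v e
    proof -
      obtain N where "norm (l2_norm (v - l2_truncate N v) - 0) < e"
        using LIMSEQ_D[OF l2_truncate_tendsto[OF l2_carrier_ell2[OF v]] \<open>e > 0\<close>] by blast
      moreover have "l2_span K (b ` carrier G) (l2_truncate N v)"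
        using v l2_unit_in_cholesky_span[OF psd q b_def]
        by (intro l2_truncate_in_span[where S = "pivots \<kappa> q"]) (auto simp: l2_carrier_def)
      ultimately show ?thesis by (intro exI[of _ "l2_truncate N v"]) simp
    qed
    show "((\<lambda>h. l2_norm (b h - b g)) \<longlongrightarrow> 0) (nhdsin T g)" if g: "g \<in> carrier G" for g
    proof -
      have "((\<lambda>h. sqrt (2 * k h g)) \<longlongrightarrow> sqrt (2 * 0)) (nhdsin T g)"
        by (intro tendsto_intros cont g)
      moreover have "\<forall>\<^sub>F h in nhdsin T g. sqrt (2 * k h g) = l2_norm (b h - b g)"
        using eventually_nhdsin_carrier
        by eventually_elim (simp add: norm g)
      ultimately show ?thesis
        by (simp cong: filterlim_cong add: tendsto_cong)
    qed
    show "compactin T (T closure_of {g \<in> carrier G. l2_norm (b g) \<le> R})" for R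
    proof -
      have "k g \<one> \<le> R\<^sup>2" if g: "g \<in> carrier G" and "l2_norm (b g) \<le> R" for g
      proof -
        have "sqrt (2 * k g \<one>) \<le> R"
          using norm[OF g one_closed] that b_one by simp
        then have "2 * k g \<one> \<le> R\<^sup>2" by (rule sqrt_le_D)
        then show ?thesis using zero_le_power2[of R] by linarith
      qed
      then have "T closure_of {g \<in> carrier G. l2_norm (b g) \<le> R} \<subseteq>
          T closure_of {g \<in> carrier G. k g \<one> \<le> R\<^sup>2}"
        by (intro closure_of_mono) blast
      then show ?thesis
        using closed_compactin[OF proper] closedin_closure_of by blast
    qed
  qed
  show ?thesis by (rule a_T_menable)
qed

section \<open>The metric of \<open>L\<^sub>p\<close>\<close>

text \<open>A crude bound from \<open>a + b \<le> 2 * max a b\<close>, valid for all positive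
  exponents; it serves to establish integrability.\<close>

lemma powr_add_le_two_powr:
  fixes a b :: real
  assumes "0 \<le> a" "0 \<le> b" "0 < p"
  shows "(a + b) powr p \<le> 2 powr p * (a powr p + b powr p)"
proof -
  have "(a + b) powr p \<le> (2 * max a b) powr p"
    using assms by (intro powr_mono2) auto
  also have "\<dots> = 2 powr p * max a b powr p"
    using assms by (intro powr_mult)
  also have "\<dots> \<le> 2 powr p * (a powr p + b powr p)"
    by (intro mult_left_mono) (auto simp: max_def)
  finally show ?thesis .
qed

text \<open>A ratio between 0 and 1 is at most its p-th power when \<open>p \<le> 1\<close>. Apply
  this to the two ratios with denominator \<open>a + b\<close>, whose sum is 1.\<close>

lemma powr_add_le:
  fixes a b :: real
  assumes "0 \<le> a" "0 \<le> b" "0 < p" "p \<le> 1"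
  shows "(a + b) powr p \<le> a powr p + b powr p"
proof (cases "a + b = 0")
  case True
  then show ?thesis using assms by simp
next
  case False
  have le: "x / (a + b) \<le> x powr p / (a + b) powr p" if "0 \<le> x" "x \<le> a + b" for x
    using powr_mono'[of p 1 "x / (a + b)"] assms that False by (simp add: powr_divide)
  have "1 = a / (a + b) + b / (a + b)"
    using False by (simp add: add_divide_distrib[symmetric])
  also have "\<dots> \<le> a powr p / (a + b) powr p + b powr p / (a + b) powr p"
    using assms by (intro add_mono le) auto
  also have "\<dots> = (a powr p + b powr p) / (a + b) powr p"
    by (simp add: add_divide_distrib)
  finally show ?thesis
    using False assms by (simp add: le_divide_eq)
qed

text \<open>For positive arguments this is convexity of the power; when one argument is 0 it reduces
  to \<open>s powr p \<le> s\<close> for \<open>s\<close> between 0 and 1.\<close>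

lemma powr_convex_combination:
  fixes u v t p :: real
  assumes "0 \<le> u" "0 \<le> v" "0 < t" "t < 1" "1 \<le> p"
  shows "((1 - t) * u + t * v) powr p \<le> (1 - t) * u powr p + t * v powr p"
proof -
  have le: "(s * w) powr p \<le> s * w powr p" if "0 < s" "s < 1" "0 \<le> w" for s w
    using powr_mono'[of 1 p s] that assms by (simp add: powr_mult mult_right_mono)
  consider "u = 0" | "v = 0" | "u > 0" "v > 0" using assms by linarith
  then show ?thesis
  proof cases
    case 1
    then show ?thesis using le[of t v] assms by simp
  next
    case 2
    then show ?thesis using le[of "1 - t" u] assms by simp
  next
    case 3
    then show ?thesis
      using convex_onD[OF powr_convex[of p], of t u v] assms by simp
  qed
qed

text \<open>After division by \<open>a + b\<close>, the sum is a convex combination of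
  \<open>f / a\<close> and \<open>g / b\<close> with weights \<open>a / (a + b)\<close> and
  \<open>b / (a + b)\<close>; convexity of the power is then integrated. Positive upper bounds
  \<open>a\<close> and \<open>b\<close> in place of the norms avoid dividing by a zero norm.\<close>

lemma Minkowski_bound:
  fixes f g :: "'m \<Rightarrow> real"
  assumes f: "\<And>x. 0 \<le> f x" "integrable M (\<lambda>x. f x powr p)" "(LINT x|M. f x powr p) \<le> a powr p"
    and g: "\<And>x. 0 \<le> g x" "integrable M (\<lambda>x. g x powr p)" "(LINT x|M. g x powr p) \<le> b powr p"
    and fg: "integrable M (\<lambda>x. (f x + g x) powr p)"
    and ab: "0 < a" "0 < b" and p: "1 \<le> p"
  shows "(LINT x|M. (f x + g x) powr p) \<le> (a + b) powr p"
proof -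
  define t where "t = b / (a + b)"
  have t: "0 < t" "t < 1" "1 - t = a / (a + b)"
    using ab by (auto simp: t_def field_simps)
  have pw: "(f x + g x) powr p \<le>
      (a + b) powr p * ((1 - t) * (f x powr p / a powr p) + t * (g x powr p / b powr p))" for x
  proof -
    have "f x + g x = (a + b) * ((1 - t) * (f x / a) + t * (g x / b))"
      using ab unfolding t(3) by (simp add: t_def distrib_left)
    then have "(f x + g x) powr p = (a + b) powr p * ((1 - t) * (f x / a) + t * (g x / b)) powr p"
      using ab t f(1) g(1) by (simp add: powr_mult)
    also have "\<dots> \<le> (a + b) powr p * ((1 - t) * (f x / a) powr p + t * (g x / b) powr p)"
      using ab t f(1) g(1) p by (intro mult_left_mono powr_convex_combination) auto
    finally show ?thesis
      using ab f(1) g(1) by (simp add: powr_divide)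
  qed
  have "(LINT x|M. (f x + g x) powr p) \<le>
      (LINT x|M. (a + b) powr p * ((1 - t) * (f x powr p / a powr p) + t * (g x powr p / b powr p)))"
    using f g fg by (intro integral_mono pw) auto
  also have "\<dots> = (a + b) powr p * ((1 - t) * ((LINT x|M. f x powr p) / a powr p)
      + t * ((LINT x|M. g x powr p) / b powr p))"
    using f g by simp
  also have "\<dots> \<le> (a + b) powr p * ((1 - t) * 1 + t * 1)"
    using f g t ab by (intro mult_left_mono add_mono) auto
  finally show ?thesis by simp
qed

text \<open>Enlarging both norms by \<open>e / 2\<close> makes them admissible bounds even when they
  vanish; then \<open>e\<close> is arbitrary.\<close>

lemma Minkowski:
  fixes f g :: "'m \<Rightarrow> real"
  assumes f: "\<And>x. 0 \<le> f x" "integrable M (\<lambda>x. f x powr p)"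
    and g: "\<And>x. 0 \<le> g x" "integrable M (\<lambda>x. g x powr p)"
    and fg: "integrable M (\<lambda>x. (f x + g x) powr p)" and p: "1 \<le> p"
  shows "(LINT x|M. (f x + g x) powr p) powr (1 / p) \<le>
    (LINT x|M. f x powr p) powr (1 / p) + (LINT x|M. g x powr p) powr (1 / p)"
proof (rule field_le_epsilon)
  fix e :: real assume "e > 0"
  define a where "a = (LINT x|M. f x powr p) powr (1 / p) + e / 2"
  define b where "b = (LINT x|M. g x powr p) powr (1 / p) + e / 2"
  have ab: "a > 0" "b > 0" using \<open>e > 0\<close> by (simp_all add: a_def b_def add_nonneg_pos)
  have le: "I \<le> (I powr (1 / p) + e / 2) powr p" if "I \<ge> 0" for I
    using powr_mono2[of p "I powr (1 / p)" "I powr (1 / p) + e / 2"] that p \<open>e > 0\<close>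
    by (simp add: powr_powr)
  have "(LINT x|M. (f x + g x) powr p) \<le> (a + b) powr p"
    by (rule Minkowski_bound[OF f _ g _ fg ab p]) (simp_all add: a_def b_def le)
  then have "(LINT x|M. (f x + g x) powr p) powr (1 / p) \<le> ((a + b) powr p) powr (1 / p)"
    using p by (intro powr_mono2) auto
  also have "\<dots> = a + b"
    using p ab by (simp add: powr_powr)
  finally show "(LINT x|M. (f x + g x) powr p) powr (1 / p) \<le>
    (LINT x|M. f x powr p) powr (1 / p) + (LINT x|M. g x powr p) powr (1 / p) + e"
    by (simp add: a_def b_def)
qed

lemma integral_psd_form:
  assumes "\<And>i j. i \<in> F \<Longrightarrow> j \<in> F \<Longrightarrow> integrable M (\<lambda>x. k x i j)"
  shows "(LINT x|M. psd_form (k x) F c) = psd_form (\<lambda>i j. LINT x|M. k x i j) F c"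
proof -
  have "(LINT x|M. psd_form (k x) F c) = (\<Sum>i\<in>F. LINT x|M. (\<Sum>j\<in>F. c i * c j * k x i j))"
    unfolding psd_form_def using assms
    by (intro Bochner_Integration.integral_sum Bochner_Integration.integrable_sum integrable_mult_right)
  also have "\<dots> = psd_form (\<lambda>i j. LINT x|M. k x i j) F c"
    unfolding psd_form_def using assms
    by (intro sum.cong refl trans[OF Bochner_Integration.integral_sum] integrable_mult_right
        integral_mult_right_zero)
  finally show ?thesis .
qed

section \<open>Almost everywhere classes: the metric and the kernel of p-th powers\<close>

locale Lp = real_or_complex K for K +
  fixes p :: real and M :: "'m measure"
  assumes p_pos: "0 < p"
begin

lemma Lp_funsD:
  assumes "f \<in> Lp_funs K p M"
  shows "f \<in> borel_measurable M" "integrable M (\<lambda>x. cmod (f x) powr p)"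
  using assms by (simp_all add: Lp_funs_def)

lemma Lp_integrable:
  assumes f: "f \<in> Lp_funs K p M" and h: "h \<in> Lp_funs K p M" and u: "u \<in> borel_measurable M"
    and le: "\<And>x. cmod (u x) \<le> cmod (f x) + cmod (h x)"
  shows "integrable M (\<lambda>x. cmod (u x) powr p)"
proof (rule Bochner_Integration.integrable_bound)
  show "integrable M (\<lambda>x. 2 powr p * (cmod (f x) powr p + cmod (h x) powr p))"
    using Lp_funsD[OF f] Lp_funsD[OF h] by simp
  show "(\<lambda>x. cmod (u x) powr p) \<in> borel_measurable M"
    using u by measurable
  have "cmod (u x) powr p \<le> 2 powr p * (cmod (f x) powr p + cmod (h x) powr p)" for x
    using powr_mono2[OF _ _ le, of p x] powr_add_le_two_powr[of "cmod (f x)" "cmod (h x)" p] p_pos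
    by simp
  then show "AE x in M. norm (cmod (u x) powr p)
      \<le> norm (2 powr p * (cmod (f x) powr p + cmod (h x) powr p))"
    by simp
qed

lemma Lp_integrable_diff:
  assumes "f \<in> Lp_funs K p M" "h \<in> Lp_funs K p M"
  shows "integrable M (\<lambda>x. cmod (f x - h x) powr p)"
  using assms Lp_funsD
  by (intro Lp_integrable[OF assms] borel_measurable_diff norm_triangle_ineq4)

lemma Lp_funs_add:
  assumes "f \<in> Lp_funs K p M" "h \<in> Lp_funs K p M"
  shows "(\<lambda>x. f x + h x) \<in> Lp_funs K p M"
  using assms Lp_integrable[OF assms, of "\<lambda>x. f x + h x", OF _ norm_triangle_ineq]
  by (auto simp: Lp_funs_def)

lemma equiv_ae_eq: "equiv (Lp_funs K p M) (ae_eq K p M)"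
proof (rule equivI)
  show "ae_eq K p M \<subseteq> Lp_funs K p M \<times> Lp_funs K p M" by (auto simp: ae_eq_def)
  show "refl_on (Lp_funs K p M) (ae_eq K p M)" by (auto simp: refl_on_def ae_eq_def)
  show "sym (ae_eq K p M)" by (auto simp: sym_def ae_eq_def)
  show "trans (ae_eq K p M)" unfolding trans_def ae_eq_def by auto
qed

lemma rep_in:
  assumes "A \<in> carrier (Lp_space K p M)"
  shows "rep A \<in> A" "rep A \<in> Lp_funs K p M"
proof -
  have A: "A \<in> Lp_funs K p M // ae_eq K p M" using assms by (simp add: Lp_space_def)
  then have "A \<noteq> {}" using in_quotient_imp_non_empty[OF equiv_ae_eq] by blast
  then show "rep A \<in> A" unfolding rep_def by (simp add: some_in_eq)
  then show "rep A \<in> Lp_funs K p M" using in_quotient_imp_subset[OF equiv_ae_eq A] by blast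
qed

lemma Lp_class_eqI:
  assumes "A \<in> carrier (Lp_space K p M)" "B \<in> carrier (Lp_space K p M)"
    and "AE x in M. rep A x = rep B x"
  shows "A = B"
  using quotient_eqI[OF equiv_ae_eq, of A B "rep A" "rep B"] assms rep_in[OF assms(1)] rep_in[OF assms(2)]
  by (simp add: Lp_space_def ae_eq_def)

lemma rep_ae_class:
  assumes "f \<in> Lp_funs K p M"
  shows "AE x in M. rep (ae_class K p M f) x = f x"
proof -
  have "ae_class K p M f \<in> carrier (Lp_space K p M)"
    using assms by (simp add: Lp_space_def quotientI)
  from rep_in(1)[OF this] show ?thesis by (auto simp: ae_eq_def eq_commute)
qed

lemma rep_add:
  assumes "A \<in> carrier (Lp_space K p M)" "B \<in> carrier (Lp_space K p M)"
  shows "AE x in M. rep (A \<oplus>\<^bsub>Lp_space K p M\<^esub> B) x = rep A x + rep B x"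
  using rep_ae_class[OF Lp_funs_add[OF rep_in(2)[OF assms(1)] rep_in(2)[OF assms(2)]]]
  by (simp add: Lp_space_def)

text \<open>The p-th power of the norm for every \<open>p\<close>: the metric itself below exponent
  1, its p-th power from 1 on. Unlike the metric it is an integral of a pointwise kernel, so
  pointwise positivity can be integrated.\<close>

definition Lp_gap :: "('m \<Rightarrow> complex) set \<Rightarrow> ('m \<Rightarrow> complex) set \<Rightarrow> real" where
  "Lp_gap A B = (LINT x|M. cmod (rep A x - rep B x) powr p)"

lemma Lp_gap_nonneg: "0 \<le> Lp_gap A B"
  by (simp add: Lp_gap_def)

lemma Lp_gap_sym: "Lp_gap A B = Lp_gap B A"
  by (simp add: Lp_gap_def norm_minus_commute)

lemma Lp_dist_eq: "Lp_dist p M A B = (if 1 \<le> p then Lp_gap A B powr (1 / p) else Lp_gap A B)"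
  using p_pos Lp_gap_nonneg[of A B] by (simp add: Lp_dist_def Lp_norm_def Let_def powr_powr flip: Lp_gap_def)

lemma Lp_gap_eq: "Lp_gap A B = (if 1 \<le> p then Lp_dist p M A B powr p else Lp_dist p M A B)"
  using Lp_gap_nonneg[of A B] by (simp add: Lp_dist_eq powr_powr)

lemma Lp_gap_eq_0_iff:
  assumes "A \<in> carrier (Lp_space K p M)" "B \<in> carrier (Lp_space K p M)"
  shows "Lp_gap A B = 0 \<longleftrightarrow> A = B"
proof
  assume "Lp_gap A B = 0"
  then have "AE x in M. cmod (rep A x - rep B x) powr p = 0"
    using integral_nonneg_eq_0_iff_AE[OF Lp_integrable_diff[OF rep_in(2)[OF assms(1)] rep_in(2)[OF assms(2)]]]
    by (simp add: Lp_gap_def)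
  then show "A = B" using assms by (intro Lp_class_eqI) auto
qed (simp add: Lp_gap_def)

text \<open>Minkowski's inequality for \<open>1 \<le> p\<close>, subadditivity of the power below
  1.\<close>

lemma Lp_dist_triangle:
  assumes "A \<in> carrier (Lp_space K p M)" "B \<in> carrier (Lp_space K p M)" "C \<in> carrier (Lp_space K p M)"
  shows "Lp_dist p M A C \<le> Lp_dist p M A B + Lp_dist p M B C"
proof -
  note A = rep_in(2)[OF assms(1)] and B = rep_in(2)[OF assms(2)] and C = rep_in(2)[OF assms(3)]
  let ?f = "\<lambda>x. cmod (rep A x - rep B x)" and ?g = "\<lambda>x. cmod (rep B x - rep C x)"
  have meas: "?f \<in> borel_measurable M" "?g \<in> borel_measurable M"
    using Lp_funsD(1)[OF A] Lp_funsD(1)[OF B] Lp_funsD(1)[OF C] by auto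
  note AB = Lp_integrable_diff[OF A B] and BC = Lp_integrable_diff[OF B C] and AC = Lp_integrable_diff[OF A C]
  have tri: "cmod (rep A x - rep C x) \<le> ?f x + ?g x" for x
    using norm_triangle_ineq[of "rep A x - rep B x" "rep B x - rep C x"] by simp
  have fg: "integrable M (\<lambda>x. (?f x + ?g x) powr p)"
  proof (rule Bochner_Integration.integrable_bound)
    show "integrable M (\<lambda>x. 2 powr p * (?f x powr p + ?g x powr p))" using AB BC by simp
    show "(\<lambda>x. (?f x + ?g x) powr p) \<in> borel_measurable M" using meas by measurable
    show "AE x in M. norm ((?f x + ?g x) powr p) \<le> norm (2 powr p * (?f x powr p + ?g x powr p))"
      using powr_add_le_two_powr[OF _ _ p_pos] by (intro AE_I2) simp
  qed
  have le: "Lp_gap A C \<le> (LINT x|M. (?f x + ?g x) powr p)"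
    unfolding Lp_gap_def using p_pos by (intro integral_mono AC fg powr_mono2 tri) auto
  show ?thesis
  proof (cases "1 \<le> p")
    case True
    have "Lp_gap A C powr (1 / p) \<le> (LINT x|M. (?f x + ?g x) powr p) powr (1 / p)"
      using le p_pos by (intro powr_mono2 Lp_gap_nonneg) auto
    also have "\<dots> \<le> Lp_gap A B powr (1 / p) + Lp_gap B C powr (1 / p)"
      unfolding Lp_gap_def by (intro Minkowski AB BC fg True) auto
    finally show ?thesis using True by (simp add: Lp_dist_eq)
  next
    case False
    have "(LINT x|M. (?f x + ?g x) powr p) \<le> (LINT x|M. ?f x powr p + ?g x powr p)"
      using False p_pos by (intro integral_mono fg powr_add_le Bochner_Integration.integrable_add AB BC) auto
    also have "\<dots> = Lp_gap A B + Lp_gap B C"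
      using AB BC by (simp add: Lp_gap_def)
    finally show ?thesis using False le by (simp add: Lp_dist_eq)
  qed
qed

lemma Lp_Metric_space: "Metric_space (carrier (Lp_space K p M)) (Lp_dist p M)"
proof
  show "0 \<le> Lp_dist p M A B" for A B by (simp add: Lp_dist_eq Lp_gap_nonneg)
  show "Lp_dist p M A B = Lp_dist p M B A" for A B by (simp add: Lp_dist_eq Lp_gap_sym)
  show "Lp_dist p M A B = 0 \<longleftrightarrow> A = B"
    if "A \<in> carrier (Lp_space K p M)" "B \<in> carrier (Lp_space K p M)" for A B
    using Lp_gap_eq_0_iff[OF that] by (simp add: Lp_dist_eq)
qed (rule Lp_dist_triangle)

text \<open>Addition of classes goes through chosen representatives, so the common summand cancels
  only almost everywhere, which the integral does not see.\<close>

lemma Lp_gap_translate: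
  assumes "A \<in> carrier (Lp_space K p M)" "B \<in> carrier (Lp_space K p M)" "C \<in> carrier (Lp_space K p M)"
  shows "Lp_gap (A \<oplus>\<^bsub>Lp_space K p M\<^esub> C) (B \<oplus>\<^bsub>Lp_space K p M\<^esub> C) = Lp_gap A B"
proof -
  have AE: "AE x in M. cmod (rep (A \<oplus>\<^bsub>Lp_space K p M\<^esub> C) x - rep (B \<oplus>\<^bsub>Lp_space K p M\<^esub> C) x) powr p =
      cmod (rep A x - rep B x) powr p"
    using rep_add[OF assms(1,3)] rep_add[OF assms(2,3)] by eventually_elim simp
  have closed: "A \<oplus>\<^bsub>Lp_space K p M\<^esub> C \<in> carrier (Lp_space K p M)"
    if "A \<in> carrier (Lp_space K p M)" for A
    using Lp_funs_add[OF rep_in(2)[OF that] rep_in(2)[OF assms(3)]]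
    by (simp add: Lp_space_def quotientI)
  show ?thesis
    unfolding Lp_gap_def
    by (rule integral_cong_AE)
      (intro borel_measurable_integrable Lp_integrable_diff rep_in(2) closed assms AE)+
qed

lemma psd_kernel_Lp_gap:
  fixes X :: "'x set"
  assumes p2: "p < 2" and F: "\<And>g. g \<in> X \<Longrightarrow> F g \<in> carrier (Lp_space K p M)" and e: "e \<in> X"
  shows "psd_kernel X (\<lambda>g h. Lp_gap (F g) (F e) + Lp_gap (F h) (F e) - Lp_gap (F g) (F h))"
  unfolding psd_kernel_def
proof (intro conjI ballI allI impI)
  fix n and z :: "nat \<Rightarrow> 'x" and c :: "nat \<Rightarrow> real"
  assume z: "\<forall>i<n. z i \<in> X"
  \<comment> \<open>Subtracting the representative at the base point \<open>e\<close> brings the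
    kernel into the form of \<open>psd_form_powr\<close>; it cancels in
    \<open>?w x i - ?w x j\<close>.\<close>
  let ?w = "\<lambda>x i. rep (F (z i)) x - rep (F e) x"
  let ?k = "\<lambda>x i j. cmod (?w x i) powr p + cmod (?w x j) powr p - cmod (?w x i - ?w x j) powr p"
  note int = Lp_integrable_diff[OF rep_in(2)[OF F] rep_in(2)[OF F]]
  have "0 \<le> (LINT x|M. psd_form (?k x) {..<n} c)"
    by (intro Bochner_Integration.integral_nonneg psd_form_powr p_pos p2)
  also have "\<dots> = psd_form (\<lambda>i j. Lp_gap (F (z i)) (F e) + Lp_gap (F (z j)) (F e) - Lp_gap (F (z i)) (F (z j))) {..<n} c"
  proof (subst integral_psd_form)
    fix i j assume "i \<in> {..<n}" "j \<in> {..<n}"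
    then show "integrable M (\<lambda>x. ?k x i j)" using z e by (simp add: int)
  next
    show "psd_form (\<lambda>i j. LINT x|M. ?k x i j) {..<n} c =
      psd_form (\<lambda>i j. Lp_gap (F (z i)) (F e) + Lp_gap (F (z j)) (F e) - Lp_gap (F (z i)) (F (z j))) {..<n} c"
      using z e by (intro psd_form_cong) (simp_all add: int Lp_gap_def)
  qed
  finally show "0 \<le> psd_form (\<lambda>i j. Lp_gap (F (z i)) (F e) + Lp_gap (F (z j)) (F e)
    - Lp_gap (F (z i)) (F (z j))) {..<n} c" .
qed (simp add: Lp_gap_sym)

end

section \<open>From the given action to its invariant proper kernel\<close>

theorem proposition8:
  fixes G :: "('g, 'c) monoid_scheme" and T :: "'g topology"
    and K :: "complex set" and p :: real and M :: "'m measure"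
  assumes "K = \<real> \<or> K = UNIV"
    and "topological_group G T" and "second_countable T" and "locally_compact_space T"
    and "0 < p" and "p < 2"
    and "admits_proper_affine_isometric_action G T K (Lp_space K p M) (Lp_dist p M)"
  shows "a_T_menable K G T"
proof -
  interpret topological_group G T by fact
  interpret Lp K p M by unfold_locales fact+
  let ?V = "Lp_space K p M" and ?d = "Lp_dist p M"
  interpret X: Metric_space "carrier ?V" ?d by (rule Lp_Metric_space)
  obtain \<Psi> \<pi> \<gamma> where rep: "isometric_representation G K ?V ?d \<pi>" and coc: "cocycle G ?V \<pi> \<gamma>"
    and \<Psi>: "\<And>g v. g \<in> carrier G \<Longrightarrow> v \<in> carrier ?V \<Longrightarrow> \<Psi> g v = \<pi> g v \<oplus>\<^bsub>?V\<^esub> \<gamma> g"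
    and cont: "\<And>v. v \<in> carrier ?V \<Longrightarrow> continuous_map T X.mtopology (\<lambda>g. \<Psi> g v)"
    and proper: "proper_action G T (carrier ?V) ?d \<Psi>"
    using assms(7) unfolding admits_proper_affine_isometric_action_def affine_isometric_action_def
    by blast
  have \<gamma>: "\<gamma> g \<in> carrier ?V" if "g \<in> carrier G" for g
    using coc that by (simp add: cocycle_def)
  have \<gamma>_mult: "\<gamma> (g \<otimes>\<^bsub>G\<^esub> h) = \<pi> g (\<gamma> h) \<oplus>\<^bsub>?V\<^esub> \<gamma> g" if "g \<in> carrier G" "h \<in> carrier G" for g h
    using coc that by (simp add: cocycle_def)
  have iso: "linear_isometry K ?V ?d (\<pi> g)" if "g \<in> carrier G" for g
    using rep that by (simp add: isometric_representation_def)
  have \<pi>: "\<pi> g v \<in> carrier ?V" if "g \<in> carrier G" "v \<in> carrier ?V" for g v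
    using bij_betwE[of "\<pi> g" "carrier ?V" "carrier ?V"] iso[OF that(1)] that(2)
    by (simp add: linear_isometry_def)
  \<comment> \<open>The cocycle is itself an orbit map, that of the point
    \<open>\<gamma> \<one>\<close>, so continuity and properness of the action transfer to
    \<open>\<gamma>\<close>.\<close>
  have \<Psi>_\<gamma>: "\<Psi> g (\<gamma> \<one>\<^bsub>G\<^esub>) = \<gamma> g" if "g \<in> carrier G" for g
    using \<gamma>_mult[of g "\<one>\<^bsub>G\<^esub>"] \<Psi>[OF that, of "\<gamma> \<one>\<^bsub>G\<^esub>"] \<gamma> that by simp
  define k where "k g h = Lp_gap (\<gamma> g) (\<gamma> h)" for g h
  show ?thesis
  proof (rule a_T_menable_if_proper_kernel[where k = k])
    show "psd_kernel (carrier G) (\<lambda>g h. k g \<one>\<^bsub>G\<^esub> + k h \<one>\<^bsub>G\<^esub> - k g h)"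
      unfolding k_def by (intro psd_kernel_Lp_gap assms \<gamma> one_closed)
    show "k g g = 0" for g by (simp add: k_def Lp_gap_def)
    show "k (s \<otimes>\<^bsub>G\<^esub> g) (s \<otimes>\<^bsub>G\<^esub> h) = k g h" if "s \<in> carrier G" "g \<in> carrier G" "h \<in> carrier G" for s g h
    proof -
      have "?d (\<pi> s (\<gamma> g)) (\<pi> s (\<gamma> h)) = ?d (\<gamma> g) (\<gamma> h)"
        using iso that \<gamma> by (simp add: linear_isometry_def)
      then have "Lp_gap (\<pi> s (\<gamma> g)) (\<pi> s (\<gamma> h)) = Lp_gap (\<gamma> g) (\<gamma> h)"
        by (simp add: Lp_gap_eq)
      then show ?thesis
        using that by (simp add: k_def \<gamma>_mult Lp_gap_translate \<pi> \<gamma>)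
    qed
    show "((\<lambda>h. k h g) \<longlongrightarrow> 0) (nhdsin T g)" if g: "g \<in> carrier G" for g
    proof -
      have d: "((\<lambda>h. ?d (\<gamma> h) (\<gamma> g)) \<longlongrightarrow> 0) (nhdsin T g)"
      proof (rule tendstoI)
        fix e :: real assume "e > 0"
        then have "\<exists>U. openin T U \<and> g \<in> U \<and>
            (\<forall>h\<in>U. \<Psi> h (\<gamma> \<one>\<^bsub>G\<^esub>) \<in> X.mball (\<Psi> g (\<gamma> \<one>\<^bsub>G\<^esub>)) e)"
          using cont[OF \<gamma>[OF one_closed]] g unfolding X.continuous_map_to_metric topspace_eq by simp
        then obtain U where U: "openin T U" "g \<in> U"
            "\<And>h. h \<in> U \<Longrightarrow> \<Psi> h (\<gamma> \<one>\<^bsub>G\<^esub>) \<in> X.mball (\<Psi> g (\<gamma> \<one>\<^bsub>G\<^esub>)) e"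
          by blast
        have "dist (?d (\<gamma> h) (\<gamma> g)) 0 < e" if "h \<in> U" for h
        proof -
          have "h \<in> carrier G" using that openin_subset[OF U(1)] topspace_eq by blast
          then show ?thesis
            using U(3)[OF that] g X.commute[of "\<gamma> h"] by (simp add: \<Psi>_\<gamma>)
        qed
        then show "\<forall>\<^sub>F h in nhdsin T g. dist (?d (\<gamma> h) (\<gamma> g)) 0 < e"
          unfolding eventually_nhdsin using U by blast
      qed
      show ?thesis
      proof (cases "1 \<le> p")
        case True
        have "((\<lambda>h. ?d (\<gamma> h) (\<gamma> g) powr p) \<longlongrightarrow> 0) (nhdsin T g)"
          using \<open>0 < p\<close> by (intro tendsto_zero_powrI[OF d tendsto_const]) auto
        then show ?thesis using True by (simp add: k_def Lp_gap_eq)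
      next
        case False
        then show ?thesis using d by (simp add: k_def Lp_gap_eq)
      qed
    qed
    show "compactin T (T closure_of {g \<in> carrier G. k g \<one>\<^bsub>G\<^esub> \<le> R})" for R
    proof -
      \<comment> \<open>The radius in the metric that corresponds to the bound \<open>R\<close> on
        the p-th power. Cutting off at 0 keeps the center in the ball even for negative
        \<open>R\<close>.\<close>
      define B where "B = (if 1 \<le> p then max 0 R powr (1 / p) else max 0 R)"
      define U where "U = X.mcball (\<gamma> \<one>\<^bsub>G\<^esub>) B"
      have "B \<ge> 0" by (simp add: B_def)
      \<comment> \<open>The ball contains both \<open>\<gamma> \<one>\<close> and its image
        \<open>\<gamma> g\<close> under \<open>\<Psi> g\<close>, so it meets its translate.\<close>
      have "g \<in> {g \<in> carrier G. \<Psi> g ` U \<inter> U \<noteq> {}}" if "g \<in> carrier G" "k g \<one>\<^bsub>G\<^esub> \<le> R" for g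
      proof -
        have "?d (\<gamma> \<one>\<^bsub>G\<^esub>) (\<gamma> g) \<le> B"
          using that(2) p_pos Lp_gap_nonneg[of "\<gamma> \<one>\<^bsub>G\<^esub>" "\<gamma> g"] Lp_gap_sym[of "\<gamma> g"]
          by (auto simp: B_def Lp_dist_eq k_def intro: powr_mono2)
        then have "\<gamma> g \<in> U" "\<gamma> \<one>\<^bsub>G\<^esub> \<in> U"
          using \<open>B \<ge> 0\<close> \<gamma> that(1) by (simp_all add: U_def)
        then show ?thesis using \<Psi>_\<gamma>[OF that(1)] that(1) by force
      qed
      then have sub: "T closure_of {g \<in> carrier G. k g \<one>\<^bsub>G\<^esub> \<le> R} \<subseteq>
          T closure_of {g \<in> carrier G. \<Psi> g ` U \<inter> U \<noteq> {}}"
        by (intro closure_of_mono) blast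
      have "X.mbounded U" unfolding U_def X.mbounded_def by blast
      then have "compactin T (T closure_of {g \<in> carrier G. \<Psi> g ` U \<inter> U \<noteq> {}})"
        using proper unfolding proper_action_def by blast
      then show ?thesis
        using closed_compactin sub closedin_closure_of by blast
    qed
  qed (use assms in simp_all)
qed

end
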